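(* Let $k$ be an algebraically closed field, $K|k$ a finitely generated field extension of transcendence degree $\geq 1$, $F$ an algebraic closure of $K$, and $U_K=\mathrm{Aut}(F|K)$. Let $(k',K',F')$ be another such triple. Then the map $$\mathrm{Isom}(F'|K',F|K)\longrightarrow \mathrm{Isom}(U_K,U_{K'}),\qquad \sigma\mapsto(\tau\mapsto\sigma^{-1}\circ\tau\circ\sigma),$$ is injective.
   Context: $\mathrm{Isom}(F'|K',F|K)$ denotes the set of field isomorphisms $\sigma:F'\to F$ with $\sigma(K')=K$. $\mathrm{Isom}(U_K,U_{K'})$ is the set of isomorphisms of profinite groups. *)

theory Defs
  imports "HOL-Computational_Algebra.Polynomial" "HOL-Library.FuncSet"
begin

text \<open>Fields are subsets of an ambient field type (the algebraic closure F).\<close>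

definition subfield :: "'a::field set \<Rightarrow> bool" where
  "subfield S \<longleftrightarrow> 0 \<in> S \<and> 1 \<in> S \<and>
     (\<forall>x\<in>S. \<forall>y\<in>S. x + y \<in> S \<and> x * y \<in> S) \<and>
     (\<forall>x\<in>S. - x \<in> S \<and> inverse x \<in> S)"

definition gen_subfield :: "'a::field set \<Rightarrow> 'a set" where
  "gen_subfield A = \<Inter>{S. subfield S \<and> A \<subseteq> S}"

definition fin_gen_ext :: "'a::field set \<Rightarrow> 'a set \<Rightarrow> bool" where
  "fin_gen_ext k K \<longleftrightarrow> subfield k \<and> subfield K \<and> k \<subseteq> K \<and>
     (\<exists>S. finite S \<and> S \<subseteq> K \<and> K = gen_subfield (k \<union> S))"

definition algebraic_over :: "'a::field set \<Rightarrow> 'a \<Rightarrow> bool" where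
  "algebraic_over k x \<longleftrightarrow> (\<exists>p. p \<noteq> 0 \<and> (\<forall>i. coeff p i \<in> k) \<and> poly p x = 0)"

text \<open>Transcendence degree of K over k is at least 1, i.e. there is an algebraically
  independent subset of K over k with one element, i.e. a transcendental element.\<close>
definition trdeg_ge_1 :: "'a::field set \<Rightarrow> 'a set \<Rightarrow> bool" where
  "trdeg_ge_1 k K \<longleftrightarrow> (\<exists>x\<in>K. \<not> algebraic_over k x)"

definition alg_closed_subfield :: "'a::field set \<Rightarrow> bool" where
  "alg_closed_subfield k \<longleftrightarrow> subfield k \<and>
     (\<forall>p. degree p \<ge> 1 \<and> (\<forall>i. coeff p i \<in> k) \<longrightarrow> (\<exists>x\<in>k. poly p x = 0))"

definition is_alg_closure_of :: "'a::field set \<Rightarrow> bool" where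
  "is_alg_closure_of K \<longleftrightarrow> alg_closed_subfield (UNIV :: 'a set) \<and>
     (\<forall>x. algebraic_over K x)"

definition good_triple :: "'a::field set \<Rightarrow> 'a set \<Rightarrow> bool" where
  "good_triple k K \<longleftrightarrow> alg_closed_subfield k \<and> fin_gen_ext k K \<and> trdeg_ge_1 k K \<and>
     is_alg_closure_of K"

definition field_iso :: "('b::field \<Rightarrow> 'a::field) \<Rightarrow> bool" where
  "field_iso \<sigma> \<longleftrightarrow> bij \<sigma> \<and> \<sigma> 1 = 1 \<and>
     (\<forall>x y. \<sigma> (x + y) = \<sigma> x + \<sigma> y \<and> \<sigma> (x * y) = \<sigma> x * \<sigma> y)"

definition Isom_ext :: "'b::field set \<Rightarrow> 'a::field set \<Rightarrow> ('b \<Rightarrow> 'a) set" where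
  "Isom_ext K' K = {\<sigma>. field_iso \<sigma> \<and> \<sigma> ` K' = K}"

definition Aut_over :: "'a::field set \<Rightarrow> ('a \<Rightarrow> 'a) set" where
  "Aut_over K = {\<tau>. field_iso \<tau> \<and> (\<forall>x\<in>K. \<tau> x = x)}"

end

theory Submission
  imports Defs "HOL-Computational_Algebra.Primes"
begin

text \<open>
  If \<open>\<sigma>\<close> and \<open>\<sigma>'\<close> induce the same map, then \<open>\<rho> = \<sigma> \<circ> \<sigma>'\<inverse>\<close> is an automorphism of \<open>F\<close> that
  preserves \<open>K\<close> and commutes with \<open>Aut(F|K)\<close>; we show \<open>\<rho> = id\<close>.

  Fix \<open>x\<close> transcendental over \<open>k\<close> and a maximal subfield \<open>k1 \<supseteq> k\<close> over which \<open>x\<close> is transcendental.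
  Then \<open>k1\<close> is algebraically closed, \<open>F\<close> is algebraic over \<open>k1(x)\<close>, and \<open>K\<close> lies in a finite
  extension \<open>L\<close> of \<open>k1(x)\<close>. Since \<open>\<rho>\<close> commutes with \<open>Aut(F|L)\<close>, Kummer theory shows for every prime
  \<open>l\<close> other than the characteristic that \<open>\<rho>(c - x)\<close> and \<open>(c - x)^e\<close> differ by an \<open>l\<close>-th power of an
  element fixed by \<open>Aut(F|L)\<close>, where \<open>\<rho>\<close> acts on the \<open>l\<close>-th roots of unity by the exponent \<open>e\<close>.
  Taking norms down to \<open>k1(x)\<close> and letting \<open>l\<close> vary, the characteristic polynomial of (a Frobenius
  power of) \<open>\<rho> x\<close>, evaluated at the corresponding power of \<open>\<rho> c\<close>, has no zeros or poles other
  than \<open>c\<close> and infinity. As this holds for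
  all \<open>c\<close> in an infinite field, a Frobenius power of \<open>c\<close> is a rational function of \<open>\<rho> c\<close>; a rational
  function that is a field homomorphism is itself a Frobenius power, and so \<open>x^(p^i) = (\<rho> x)^(p^j)\<close>.
  The roots of unity show that \<open>j - i\<close> does not depend on \<open>x\<close>, so \<open>\<rho>\<close> is a power of Frobenius. If it
  were a nontrivial one, \<open>\<rho>(K) = K\<close> would make \<open>K\<close> perfect, which is impossible for a finitely
  generated extension with a transcendental element.
\<close>

subsection \<open>The characteristic exponent\<close>

text \<open>The value 1 in characteristic zero makes Frobenius powers trivial there, so both cases
  share one argument.\<close>

definition char_exp :: "'a::field itself \<Rightarrow> nat" where
  "char_exp _ = (if CHAR('a) = 0 then 1 else CHAR('a))"

lemma char_exp_pos: "char_exp TYPE('a::field) > 0"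
  by (simp add: char_exp_def)

lemma prime_CHAR_field: "CHAR('a::field) \<noteq> 0 \<Longrightarrow> prime CHAR('a)"
  using prime_CHAR_semidom by blast

lemma add_power_char_exp:
  fixes x y :: "'a::field"
  shows "(x + y) ^ (char_exp TYPE('a) ^ n) = x ^ (char_exp TYPE('a) ^ n) + y ^ (char_exp TYPE('a) ^ n)"
  by (auto simp: char_exp_def prime_CHAR_field intro!: freshmans_dream')

lemma add_power_char_exp_poly:
  fixes x y :: "'a::field poly"
  shows "(x + y) ^ (char_exp TYPE('a) ^ n) = x ^ (char_exp TYPE('a) ^ n) + y ^ (char_exp TYPE('a) ^ n)"
  by (auto simp: char_exp_def prime_CHAR_field intro!: freshmans_dream')

lemma minus_power_char_exp:
  fixes x :: "'a::field"
  shows "(- x) ^ (char_exp TYPE('a) ^ n) = - (x ^ (char_exp TYPE('a) ^ n))"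
  using add_power_char_exp[of x "- x" n] char_exp_pos[where 'a='a]
  by (simp add: power_0_left eq_neg_iff_add_eq_0 add.commute)

lemma diff_power_char_exp:
  fixes x y :: "'a::field"
  shows "(x - y) ^ (char_exp TYPE('a) ^ n) = x ^ (char_exp TYPE('a) ^ n) - y ^ (char_exp TYPE('a) ^ n)"
  using add_power_char_exp[of x "- y" n] by (simp add: minus_power_char_exp)

lemma power_char_exp_inj:
  fixes x y :: "'a::field"
  assumes "x ^ (char_exp TYPE('a) ^ n) = y ^ (char_exp TYPE('a) ^ n)"
  shows "x = y"
  using diff_power_char_exp[of x y n] assms by simp

text \<open>Dividing repeatedly by the characteristic isolates the inseparable part of a degree;
  what is left is invertible in the field.\<close>

lemma char_exp_decomp:
  assumes "m > 0"
  shows "\<exists>n m'. m = char_exp TYPE('a::field) ^ n * m' \<and> m' > 0 \<and> of_nat m' \<noteq> (0::'a)"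
  using assms
proof (induction m rule: less_induct)
  case (less m)
  show ?case
  proof (cases "of_nat m = (0::'a)")
    case False
    then show ?thesis using less.prems by (intro exI[of _ 0] exI[of _ m]) auto
  next
    case True
    hence dvd: "CHAR('a) dvd m" using of_nat_eq_0_iff_char_dvd by blast
    hence c: "CHAR('a) \<noteq> 0" using less.prems by auto
    obtain l where l: "m = CHAR('a) * l" using dvd by auto
    have "CHAR('a) > 1" using prime_CHAR_field[OF c] prime_gt_1_nat by blast
    hence "l < m" "l > 0" using l less.prems by auto
    then obtain n m' where "l = char_exp TYPE('a) ^ n * m'" "m' > 0" "of_nat m' \<noteq> (0::'a)"
      using less.IH by blast
    thus ?thesis using l c by (intro exI[of _ "Suc n"] exI[of _ m']) (auto simp: char_exp_def)
  qed
qed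

text \<open>Compares coefficients in \<open>(1 + X)^m = (X^q + 1)^m'\<close>, with \<open>q\<close>
  the power of the characteristic exponent: a special case of Lucas's theorem.\<close>

lemma choose_char_exp:
  assumes m: "m = char_exp TYPE('a::field) ^ n * m'" and "m' > 0"
  shows "of_nat (m choose (char_exp TYPE('a) ^ n)) = (of_nat m' :: 'a)"
proof -
  let ?q = "char_exp TYPE('a) ^ n"
  have q: "?q > 0" using char_exp_pos by auto
  have "[:1, 1:] ^ ?q = ([:1:] + [:0, 1:] :: 'a poly) ^ ?q" by simp
  also have "\<dots> = 1 + monom 1 ?q"
    unfolding add_power_char_exp_poly by (simp add: monom_altdef one_pCons[symmetric])
  finally have "[:1, 1:] ^ m = (monom 1 ?q + 1 :: 'a poly) ^ m'"
    by (simp add: m power_mult add.commute)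
  also have "\<dots> = (\<Sum>k\<le>m'. of_nat (m' choose k) * monom 1 ?q ^ k)"
    by (simp add: binomial_ring)
  also have "\<dots> = (\<Sum>k\<le>m'. monom (of_nat (m' choose k)) (?q * k))"
    by (intro sum.cong) (auto simp: monom_power of_nat_poly mult_monom smult_monom)
  finally have "coeff ([:1, 1:] ^ m) ?q = (\<Sum>k\<le>m'. coeff (monom (of_nat (m' choose k) :: 'a) (?q * k)) ?q)"
    by (simp add: coeff_sum)
  also have "\<dots> = (\<Sum>k\<le>m'. if k = 1 then of_nat m' else 0)"
    using q by (intro sum.cong) auto
  also have "\<dots> = of_nat m'" using \<open>m' > 0\<close> by (subst sum.delta) auto
  finally have "coeff ([:1, 1:] ^ m) ?q = (of_nat m' :: 'a)" .
  moreover have "?q \<le> m" using \<open>m' > 0\<close> m by simp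
  ultimately show ?thesis by (simp add: coeff_linear_poly_power)
qed

subsection \<open>Polynomials over a subfield\<close>

definition poly_over :: "'a::field set \<Rightarrow> 'a poly set" where
  "poly_over E = {p. \<forall>i. coeff p i \<in> E}"

lemma algebraic_over_iff: "algebraic_over E x \<longleftrightarrow> (\<exists>p\<in>poly_over E. p \<noteq> 0 \<and> poly p x = 0)"
  by (auto simp: algebraic_over_def poly_over_def)

lemma algebraic_over_mono: "E \<subseteq> E' \<Longrightarrow> algebraic_over E x \<Longrightarrow> algebraic_over E' x"
  by (auto simp: algebraic_over_def)

lemma
  assumes "subfield E"
  shows subfield_0: "0 \<in> E" and subfield_1: "1 \<in> E"
    and subfield_add: "x \<in> E \<Longrightarrow> y \<in> E \<Longrightarrow> x + y \<in> E"
    and subfield_mult: "x \<in> E \<Longrightarrow> y \<in> E \<Longrightarrow> x * y \<in> E"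
    and subfield_minus: "x \<in> E \<Longrightarrow> - x \<in> E"
    and subfield_inverse: "x \<in> E \<Longrightarrow> inverse x \<in> E"
  using assms by (auto simp: subfield_def)

lemma subfield_diff: "subfield E \<Longrightarrow> x \<in> E \<Longrightarrow> y \<in> E \<Longrightarrow> x - y \<in> E"
  using subfield_add[of E x "- y"] subfield_minus[of E y] by simp

lemma subfield_divide: "subfield E \<Longrightarrow> x \<in> E \<Longrightarrow> y \<in> E \<Longrightarrow> x / y \<in> E"
  using subfield_mult[of E x "inverse y"] subfield_inverse[of E y] by (simp add: divide_inverse)

lemma subfield_power: "subfield E \<Longrightarrow> x \<in> E \<Longrightarrow> x ^ n \<in> E"
  by (induction n) (auto intro: subfield_1 subfield_mult)

lemma subfield_sum: "subfield E \<Longrightarrow> (\<And>i. i \<in> A \<Longrightarrow> f i \<in> E) \<Longrightarrow> sum f A \<in> E"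
  by (induction A rule: infinite_finite_induct) (auto intro: subfield_0 subfield_add)

lemma subfield_of_nat: "subfield E \<Longrightarrow> of_nat n \<in> E"
  by (induction n) (auto intro: subfield_0 subfield_1 subfield_add)

lemmas subfield_intros =
  subfield_0 subfield_1 subfield_add subfield_mult subfield_minus subfield_inverse
  subfield_diff subfield_divide subfield_power subfield_sum subfield_of_nat

lemma poly_over_coeff: "p \<in> poly_over E \<Longrightarrow> coeff p i \<in> E"
  by (auto simp: poly_over_def)

lemma poly_over_add: "subfield E \<Longrightarrow> p \<in> poly_over E \<Longrightarrow> q \<in> poly_over E \<Longrightarrow> p + q \<in> poly_over E"
  by (auto simp: poly_over_def intro: subfield_intros)

lemma poly_over_diff: "subfield E \<Longrightarrow> p \<in> poly_over E \<Longrightarrow> q \<in> poly_over E \<Longrightarrow> p - q \<in> poly_over E"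
  by (auto simp: poly_over_def intro: subfield_intros)

lemma poly_over_minus: "subfield E \<Longrightarrow> p \<in> poly_over E \<Longrightarrow> - p \<in> poly_over E"
  by (auto simp: poly_over_def intro: subfield_intros)

lemma poly_over_mult: "subfield E \<Longrightarrow> p \<in> poly_over E \<Longrightarrow> q \<in> poly_over E \<Longrightarrow> p * q \<in> poly_over E"
  by (auto simp: poly_over_def coeff_mult intro!: subfield_intros)

lemma poly_over_smult: "subfield E \<Longrightarrow> a \<in> E \<Longrightarrow> p \<in> poly_over E \<Longrightarrow> smult a p \<in> poly_over E"
  by (auto simp: poly_over_def intro!: subfield_intros)

lemma poly_over_pCons: "subfield E \<Longrightarrow> a \<in> E \<Longrightarrow> p \<in> poly_over E \<Longrightarrow> pCons a p \<in> poly_over E"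
  by (auto simp: poly_over_def coeff_pCons split: nat.splits)

lemma poly_over_0: "subfield E \<Longrightarrow> 0 \<in> poly_over E"
  by (auto simp: poly_over_def intro: subfield_0)

lemma poly_over_1: "subfield E \<Longrightarrow> 1 \<in> poly_over E"
  by (auto simp: poly_over_def intro: subfield_intros)

lemma poly_over_monom: "subfield E \<Longrightarrow> a \<in> E \<Longrightarrow> monom a n \<in> poly_over E"
  by (auto simp: poly_over_def intro: subfield_intros)

lemma poly_over_power: "subfield E \<Longrightarrow> p \<in> poly_over E \<Longrightarrow> p ^ n \<in> poly_over E"
  by (induction n) (auto intro: poly_over_1 poly_over_mult)

lemma poly_over_sum: "subfield E \<Longrightarrow> (\<And>i. i \<in> A \<Longrightarrow> f i \<in> poly_over E) \<Longrightarrow> sum f A \<in> poly_over E"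
  by (induction A rule: infinite_finite_induct) (auto intro: poly_over_0 poly_over_add)

lemma poly_over_prod: "subfield E \<Longrightarrow> (\<And>i. i \<in> A \<Longrightarrow> f i \<in> poly_over E) \<Longrightarrow> prod f A \<in> poly_over E"
  by (induction A rule: infinite_finite_induct) (auto intro: poly_over_1 poly_over_mult)

lemmas poly_over_intros =
  poly_over_add poly_over_diff poly_over_minus poly_over_mult poly_over_smult poly_over_pCons
  poly_over_0 poly_over_1 poly_over_monom poly_over_power poly_over_sum poly_over_prod

lemma poly_over_mono: "E \<subseteq> E' \<Longrightarrow> poly_over E \<subseteq> poly_over E'"
  by (auto simp: poly_over_def)

text \<open>Long division only ever divides by the leading coefficient of \<open>g\<close>, so all
  intermediate results stay over \<open>E\<close>.\<close>

lemma poly_over_div_mod_exists: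
  assumes E: "subfield E" and g: "g \<in> poly_over E" "g \<noteq> 0" and f: "f \<in> poly_over E"
  shows "\<exists>q\<in>poly_over E. \<exists>r\<in>poly_over E. f = q * g + r \<and> (r = 0 \<or> degree r < degree g)"
  using f
proof (induction "degree f" arbitrary: f rule: less_induct)
  case less
  show ?case
  proof (cases "f = 0 \<or> degree f < degree g")
    case True
    then show ?thesis using less.prems E
      by (intro bexI[of _ 0] bexI[of _ f]) (auto intro: poly_over_0)
  next
    case False
    define t where "t = monom (lead_coeff f / lead_coeff g) (degree f - degree g)"
    define f' where "f' = f - t * g"
    have t: "t \<in> poly_over E" unfolding t_def
      using E less.prems g by (intro poly_over_intros subfield_intros) (auto intro: poly_over_coeff)
    have f'E: "f' \<in> poly_over E" unfolding f'_def using E t less.prems g by (intro poly_over_intros)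
    have f': "f' = 0 \<or> degree f' < degree f"
    proof (cases "degree f = 0")
      case True
      hence "degree g = 0" using False by auto
      then obtain a b where "f = [:a:]" "g = [:b:]" using True by (metis degree_eq_zeroE)
      thus ?thesis using g by (auto simp: f'_def t_def monom_0)
    next
      case F: False
      have "degree (t * g) = degree f"
        using False g F by (auto simp: t_def degree_mult_eq degree_monom_eq)
      moreover have "lead_coeff (t * g) = lead_coeff f"
        using False g by (simp only: lead_coeff_mult) (simp add: t_def degree_monom_eq)
      ultimately have "degree f' \<le> degree f" "coeff f' (degree f) = 0"
        by (auto simp: f'_def intro: degree_diff_le)
      hence "f' = 0 \<or> degree f' < degree f" using F
        by (metis leading_coeff_0_iff nat_less_le)
      thus ?thesis .
    qed
    have "\<exists>q\<in>poly_over E. \<exists>r\<in>poly_over E. f' = q * g + r \<and> (r = 0 \<or> degree r < degree g)"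
    proof (cases "f' = 0")
      case True
      then show ?thesis using E by (intro bexI[of _ 0]) (auto intro: poly_over_0)
    next
      case False
      then show ?thesis using f' f'E less.hyps by auto
    qed
    then obtain q r where "q \<in> poly_over E" "r \<in> poly_over E" "f' = q * g + r"
      "r = 0 \<or> degree r < degree g" by blast
    thus ?thesis using t E
      by (intro bexI[of _ "q + t"] bexI[of _ r]) (auto simp: f'_def algebra_simps intro: poly_over_intros)
  qed
qed

text \<open>Division over \<open>E\<close> leaves a remainder that is both a multiple of
  \<open>g\<close> and of smaller degree, hence zero.\<close>

lemma poly_over_factor:
  assumes E: "subfield E" and g: "g \<in> poly_over E" "g \<noteq> 0" and f: "g * h \<in> poly_over E"
  shows "h \<in> poly_over E"
proof -
  obtain q r where qr: "q \<in> poly_over E" "g * h = q * g + r" "r = 0 \<or> degree r < degree g"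
    using poly_over_div_mod_exists[OF E g f] by blast
  have "r = g * (h - q)" using qr(2) by (simp add: algebra_simps)
  hence "h - q = 0" using qr(3) g(2) by (cases "h - q = 0") (auto simp: degree_mult_eq)
  hence "h = q" by simp
  thus ?thesis using qr by simp
qed

text \<open>An annihilating polynomial of least degree has nonzero constant term when
  \<open>y\<close> is nonzero; isolating that term gives the inverse. For \<open>y = 0\<close> the
  convention \<open>inverse 0 = 0\<close> applies.\<close>

lemma algebraic_inverse:
  assumes E: "subfield E" and y: "algebraic_over E y"
  shows "\<exists>h\<in>poly_over E. inverse y = poly h y"
proof (cases "y = 0")
  case True
  thus ?thesis using E by (intro bexI[of _ 0]) (auto intro: poly_over_0)
next
  case False
  let ?P = "\<lambda>p. p \<in> poly_over E \<and> p \<noteq> 0 \<and> poly p y = 0"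
  have "\<exists>p. ?P p" using y by (auto simp: algebraic_over_iff)
  then obtain p where p: "?P p" and min: "\<And>q. ?P q \<Longrightarrow> degree p \<le> degree q"
    using exists_least_iff[of "\<lambda>n. \<exists>p. ?P p \<and> degree p = n"] by (metis linorder_not_le)
  obtain a q where pq: "p = pCons a q" by (cases p) auto
  have q: "q \<in> poly_over E" "a \<in> E" using p unfolding pq poly_over_def
    by (auto simp: coeff_pCons split: nat.splits)
  have "a \<noteq> 0"
  proof
    assume "a = 0"
    hence "?P q" using p q False pq by auto
    hence "degree p \<le> degree q" by (rule min)
    thus False using \<open>?P q\<close> pq by auto
  qed
  moreover have "a + y * poly q y = 0" using p pq by simp
  ultimately have "inverse y = poly (smult (- inverse a) q) y"
    using False by (simp add: field_simps eq_neg_iff_add_eq_0 add.commute)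
  thus ?thesis using q E by (intro bexI[of _ "smult (- inverse a) q"]) (auto intro!: poly_over_intros subfield_intros)
qed

subsection \<open>Finite extensions\<close>

text \<open>Gaussian elimination by induction on the set \<open>B\<close> of equations: an equation
  that involves the unknown \<open>j\<close> serves to eliminate it from the others.\<close>

lemma homogeneous_system_nontrivial_solution:
  fixes a :: "'i \<Rightarrow> 'b \<Rightarrow> 'a::field"
  assumes E: "subfield E" and "finite B" and "finite I" and "card B < card I"
    and "\<And>i b. i \<in> I \<Longrightarrow> b \<in> B \<Longrightarrow> a i b \<in> E"
  shows "\<exists>c. (\<forall>i\<in>I. c i \<in> E) \<and> (\<exists>i\<in>I. c i \<noteq> 0) \<and> (\<forall>b\<in>B. (\<Sum>i\<in>I. c i * a i b) = 0)"
  using assms(2-5)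
proof (induction B arbitrary: I a rule: finite_induct)
  case empty
  then obtain i where "i \<in> I" by fastforce
  thus ?case using E by (intro exI[of _ "\<lambda>_. 1"]) (auto intro: subfield_1)
next
  case (insert b B)
  show ?case
  proof (cases "\<forall>i\<in>I. a i b = 0")
    case True
    have "\<exists>c. (\<forall>i\<in>I. c i \<in> E) \<and> (\<exists>i\<in>I. c i \<noteq> 0) \<and> (\<forall>b\<in>B. (\<Sum>i\<in>I. c i * a i b) = 0)"
    proof (rule insert.IH)
      show "card B < card I" using insert.prems insert.hyps by simp
    qed (use insert.prems in auto)
    then obtain c where c: "\<forall>i\<in>I. c i \<in> E" "\<exists>i\<in>I. c i \<noteq> 0"
      "\<forall>b\<in>B. (\<Sum>i\<in>I. c i * a i b) = 0" by blast
    have "(\<Sum>i\<in>I. c i * a i b) = 0" using True by (intro sum.neutral) simp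
    thus ?thesis using c by (intro exI[of _ c]) simp
  next
    case False
    then obtain j where j: "j \<in> I" "a j b \<noteq> 0" by blast
    define I' where "I' = I - {j}"
    define a' where "a' i b' = a i b' - a i b / a j b * a j b'" for i b'
    have "\<exists>c. (\<forall>i\<in>I'. c i \<in> E) \<and> (\<exists>i\<in>I'. c i \<noteq> 0) \<and> (\<forall>b\<in>B. (\<Sum>i\<in>I'. c i * a' i b) = 0)"
    proof (rule insert.IH)
      show "finite I'" using insert.prems by (simp add: I'_def)
      show "card B < card I'" using insert.prems insert.hyps j by (simp add: I'_def)
      show "a' i b' \<in> E" if "i \<in> I'" "b' \<in> B" for i b'
        unfolding a'_def using that insert.prems j E
        by (intro subfield_diff subfield_mult subfield_divide) (auto simp: I'_def)
    qed
    then obtain c where c: "\<forall>i\<in>I'. c i \<in> E" "\<exists>i\<in>I'. c i \<noteq> 0"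
      "\<forall>b\<in>B. (\<Sum>i\<in>I'. c i * a' i b) = 0" by blast
    \<comment> \<open>The eliminated unknown is recovered by solving equation \<open>b\<close> for
      it.\<close>
    define c' where "c' = c(j := - (\<Sum>i\<in>I'. c i * a i b / a j b))"
    have split: "(\<Sum>i\<in>I. c' i * a i b') = c' j * a j b' + (\<Sum>i\<in>I'. c i * a i b')" for b'
      using j insert.prems by (auto simp: sum.remove[of I j] I'_def c'_def intro!: sum.cong)
    have sums: "(\<Sum>i\<in>I. c' i * a i b') = (\<Sum>i\<in>I'. c i * a' i b')" for b'
      unfolding split
      by (simp add: c'_def a'_def sum_subtractf right_diff_distrib sum_distrib_right mult.assoc)
    have "c' i \<in> E" if "i \<in> I" for i
      using that c(1) E j insert.prems
      by (auto simp: c'_def I'_def intro!: subfield_intros)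
    moreover have "\<exists>i\<in>I. c' i \<noteq> 0" using c(2) by (auto simp: c'_def I'_def)
    moreover have "(\<Sum>i\<in>I. c' i * a i b') = 0" if "b' \<in> insert b B" for b'
    proof (cases "b' = b")
      case True
      thus ?thesis unfolding sums a'_def using j by simp
    next
      case False
      thus ?thesis unfolding sums using c(3) that by auto
    qed
    ultimately show ?thesis by blast
  qed
qed

definition span_over :: "'a::field set \<Rightarrow> 'a set \<Rightarrow> 'a set" where
  "span_over E B = {\<Sum>b\<in>B. c b * b | c. \<forall>b\<in>B. c b \<in> E}"

text \<open>The coordinates with respect to \<open>B\<close> form a homogeneous system with more
  unknowns than equations. An indexed family allows repeated values, such as coinciding powers of
  one element.\<close>

lemma linear_dependence:
  assumes E: "subfield E" and "finite B" and "finite I" and "card B < card I"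
    and v: "\<And>i. i \<in> I \<Longrightarrow> v i \<in> span_over E B"
  shows "\<exists>c. (\<forall>i\<in>I. c i \<in> E) \<and> (\<exists>i\<in>I. c i \<noteq> 0) \<and> (\<Sum>i\<in>I. c i * v i) = 0"
proof -
  have "\<forall>i\<in>I. \<exists>a. (\<forall>b\<in>B. a b \<in> E) \<and> v i = (\<Sum>b\<in>B. a b * b)"
    using v by (fastforce simp: span_over_def)
  then obtain a where a: "\<And>i b. i \<in> I \<Longrightarrow> b \<in> B \<Longrightarrow> a i b \<in> E"
    "\<And>i. i \<in> I \<Longrightarrow> v i = (\<Sum>b\<in>B. a i b * b)" by metis
  obtain c where c: "\<forall>i\<in>I. c i \<in> E" "\<exists>i\<in>I. c i \<noteq> 0" "\<forall>b\<in>B. (\<Sum>i\<in>I. c i * a i b) = 0"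
    using homogeneous_system_nontrivial_solution[OF E assms(2-4), of a] a(1) by blast
  have "(\<Sum>i\<in>I. c i * v i) = (\<Sum>i\<in>I. \<Sum>b\<in>B. c i * a i b * b)"
    by (intro sum.cong) (auto simp: a(2) sum_distrib_left mult.assoc)
  also have "\<dots> = (\<Sum>b\<in>B. (\<Sum>i\<in>I. c i * a i b) * b)"
    by (subst sum.swap) (simp add: sum_distrib_right)
  also have "\<dots> = 0" using c(3) by simp
  finally show ?thesis using c by blast
qed

lemma span_over_0: "subfield E \<Longrightarrow> 0 \<in> span_over E B"
  unfolding span_over_def by (auto intro!: exI[of _ "\<lambda>_. 0"] subfield_0)

lemma span_over_add:
  assumes "subfield E" "u \<in> span_over E B" "v \<in> span_over E B" shows "u + v \<in> span_over E B"
proof -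
  obtain c d where "\<forall>b\<in>B. c b \<in> E" "u = (\<Sum>b\<in>B. c b * b)" "\<forall>b\<in>B. d b \<in> E" "v = (\<Sum>b\<in>B. d b * b)"
    using assms by (auto simp: span_over_def)
  thus ?thesis using assms(1) unfolding span_over_def
    by (auto intro!: exI[of _ "\<lambda>b. c b + d b"] subfield_add simp: sum.distrib algebra_simps)
qed

lemma span_over_sum:
  "subfield E \<Longrightarrow> (\<And>i. i \<in> A \<Longrightarrow> f i \<in> span_over E B) \<Longrightarrow> sum f A \<in> span_over E B"
  by (induction A rule: infinite_finite_induct) (auto intro: span_over_0 span_over_add)

lemma span_over_base:
  assumes "subfield E" "finite B" "b \<in> B" "a \<in> E" shows "a * b \<in> span_over E B"
  unfolding span_over_def using assms
  by (auto intro!: exI[of _ "\<lambda>b'. if b' = b then a else 0"] simp: if_distrib[of "\<lambda>x. x * _"] subfield_0 cong: if_cong)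

lemma algebraic_if_powers_in_span:
  assumes E: "subfield E" and B: "finite B" and "\<And>i. y ^ i \<in> span_over E B"
  shows "algebraic_over E y"
proof -
  let ?I = "{..card B}"
  obtain c where c: "\<forall>i\<in>?I. c i \<in> E" "\<exists>i\<in>?I. c i \<noteq> 0" "(\<Sum>i\<in>?I. c i * y ^ i) = 0"
    using linear_dependence[OF E B, of ?I "\<lambda>i. y ^ i"] assms(3) by auto
  define p where "p = (\<Sum>i\<in>?I. monom (c i) i)"
  have co: "coeff p i = (if i \<in> ?I then c i else 0)" for i
    by (simp add: p_def coeff_sum)
  have "p \<in> poly_over E" unfolding p_def using E c by (intro poly_over_intros) auto
  moreover have "p \<noteq> 0" using c(2) co by (metis coeff_0)
  moreover have "poly p y = 0" using c(3) by (simp add: p_def poly_sum poly_monom)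
  ultimately show ?thesis by (auto simp: algebraic_over_iff)
qed

section \<open>Finite extensions and algebraic elements\<close>

text \<open>A finite spanning set takes the place of a basis: a bound on the dimension is enough to
  produce algebraic relations.\<close>

definition fin_ext :: "'a::field set \<Rightarrow> 'a set \<Rightarrow> bool" where
  "fin_ext E L \<longleftrightarrow> subfield L \<and> E \<subseteq> L \<and> (\<exists>B. finite B \<and> L \<subseteq> span_over E B)"

lemma fin_ext_algebraic:
  assumes "subfield E" "fin_ext E L" "y \<in> L" shows "algebraic_over E y"
proof -
  obtain B where "finite B" "L \<subseteq> span_over E B" "subfield L" using assms by (auto simp: fin_ext_def)
  thus ?thesis using assms subfield_power[of L y] by (intro algebraic_if_powers_in_span[of E B]) auto
qed

lemma fin_ext_self: "subfield E \<Longrightarrow> fin_ext E E"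
  using span_over_base[of E "{1}" 1] by (auto simp: fin_ext_def intro!: exI[of _ "{1}"])

text \<open>The extension is \<open>L[s]\<close>, spanned by the products of elements of
  \<open>B\<close> with the powers of \<open>s\<close> below the degree of \<open>p\<close>.\<close>

lemma fin_ext_adjoin:
  assumes E: "subfield E" and L: "fin_ext E L" and s: "algebraic_over L s"
  shows "\<exists>L'. fin_ext E L' \<and> L \<subseteq> L' \<and> s \<in> L'"
proof -
  obtain B where B: "finite B" "L \<subseteq> span_over E B" and sL: "subfield L" and EL: "E \<subseteq> L"
    using L by (auto simp: fin_ext_def)
  obtain p where p: "p \<in> poly_over L" "p \<noteq> 0" "poly p s = 0" using s by (auto simp: algebraic_over_iff)
  define n where "n = degree p"
  define B' where "B' = (\<lambda>(b, i). b * s ^ i) ` (B \<times> {..<n})"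
  have B': "finite B'" using B by (simp add: B'_def)
  define L' where "L' = (\<lambda>h. poly h s) ` poly_over L"
  have n: "n > 0" using p by (cases p) (auto simp: n_def split: if_splits)
  have span: "L' \<subseteq> span_over E B'"
  proof
    fix y assume "y \<in> L'"
    then obtain h where h: "h \<in> poly_over L" "y = poly h s" by (auto simp: L'_def)
    obtain q r where qr: "r \<in> poly_over L" "h = q * p + r" "r = 0 \<or> degree r < n"
      using poly_over_div_mod_exists[OF sL p(1,2) h(1)] by (auto simp: n_def)
    have "y = poly r s" using h qr p by simp
    also have "\<dots> = (\<Sum>i\<le>degree r. coeff r i * s ^ i)" by (rule poly_altdef)
    also have "\<dots> = (\<Sum>i<n. coeff r i * s ^ i)"
      using qr(3) n by (intro sum.mono_neutral_left) (auto simp: coeff_eq_0)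
    also have "\<dots> \<in> span_over E B'"
    proof (intro span_over_sum[OF E])
      fix i assume i: "i \<in> {..<n}"
      have "coeff r i \<in> span_over E B" using qr(1) B by (auto simp: poly_over_def)
      then obtain c where c: "\<forall>b\<in>B. c b \<in> E" "coeff r i = (\<Sum>b\<in>B. c b * b)"
        by (auto simp: span_over_def)
      have "coeff r i * s ^ i = (\<Sum>b\<in>B. c b * (b * s ^ i))"
        by (simp add: c sum_distrib_right mult.assoc)
      also have "\<dots> \<in> span_over E B'"
        using c B' i by (intro span_over_sum[OF E] span_over_base[OF E]) (auto simp: B'_def)
      finally show "coeff r i * s ^ i \<in> span_over E B'" .
    qed
    finally show "y \<in> span_over E B'" .
  qed
  have add: "u + v \<in> L'" and mult: "u * v \<in> L'" if uv: "u \<in> L'" "v \<in> L'" for u v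
  proof -
    obtain f g where fg: "f \<in> poly_over L" "g \<in> poly_over L" "u = poly f s" "v = poly g s"
      using uv by (auto simp: L'_def)
    show "u + v \<in> L'" using fg sL unfolding L'_def
      by (intro image_eqI[of _ _ "f + g"]) (auto intro: poly_over_intros)
    show "u * v \<in> L'" using fg sL unfolding L'_def
      by (intro image_eqI[of _ _ "f * g"]) (auto intro: poly_over_intros)
  qed
  have LL': "L \<subseteq> L'" unfolding L'_def
    using sL by (auto intro!: image_eqI[of _ _ "[:_:]"] poly_over_intros)
  have zo: "0 \<in> L'" "1 \<in> L'" "-1 \<in> L'"
    using LL' subfield_0[OF sL] subfield_1[OF sL] subfield_minus[OF sL] by auto
  have pow: "y ^ i \<in> L'" if "y \<in> L'" for y i
    by (induction i) (use that mult zo in auto)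
  have ev: "poly h y \<in> L'" if "y \<in> L'" "h \<in> poly_over E" for h y
  proof -
    have sumL: "sum f A \<in> L'" if "\<And>i. i \<in> A \<Longrightarrow> f i \<in> L'" for f and A :: "nat set"
      using that by (induction A rule: infinite_finite_induct) (use add zo in auto)
    have "coeff h i \<in> L'" for i using that EL LL' by (auto simp: poly_over_def)
    thus ?thesis unfolding poly_altdef by (intro sumL mult pow that(1))
  qed
  have "inverse y \<in> L'" if y: "y \<in> L'" for y
  proof -
    \<comment> \<open>All powers of \<open>y\<close> lie in one finite span, so \<open>y\<close> is
      algebraic and its inverse is a polynomial in \<open>y\<close>, which stays in the ring
      \<open>L'\<close>.\<close>
    have "algebraic_over E y" using pow[OF y] span by (intro algebraic_if_powers_in_span[OF E B']) auto
    then obtain h where "h \<in> poly_over E" "inverse y = poly h y" using algebraic_inverse[OF E] by blast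
    thus ?thesis using ev y by simp
  qed
  moreover have "- y \<in> L'" if "y \<in> L'" for y
    using mult[of "-1" y] that zo by auto
  ultimately have "subfield L'" using add mult zo
    by (auto simp: subfield_def)
  moreover have "s \<in> L'" unfolding L'_def
    using sL by (intro image_eqI[of _ _ "[:0, 1:]"]) (auto intro!: poly_over_intros subfield_intros)
  ultimately show ?thesis using B' span EL LL' by (intro exI[of _ L']) (auto simp: fin_ext_def)
qed

lemma fin_ext_adjoin_finite:
  assumes E: "subfield E" and "finite S" and "\<And>s. s \<in> S \<Longrightarrow> algebraic_over E s"
  shows "\<exists>L. fin_ext E L \<and> S \<subseteq> L"
  using assms(2,3)
proof (induction S rule: finite_induct)
  case empty
  then show ?case using fin_ext_self[OF E] by blast
next
  case (insert s S)
  then obtain L where L: "fin_ext E L" "S \<subseteq> L" by auto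
  have "algebraic_over L s" using insert.prems[of s] L algebraic_over_mono[of E L]
    by (auto simp: fin_ext_def)
  then obtain L' where "fin_ext E L'" "L \<subseteq> L'" "s \<in> L'" using fin_ext_adjoin[OF E L(1)] by blast
  thus ?case using L by blast
qed

lemma finite_range_coeff: "finite (range (coeff p))"
proof -
  have "range (coeff p) \<subseteq> coeff p ` {..degree p} \<union> {0}"
    by (auto simp: image_iff) (metis atMost_iff coeff_eq_0 linorder_not_le)
  thus ?thesis using finite_subset by blast
qed

text \<open>Only the finitely many coefficients of one polynomial matter; adjoining them and then
  \<open>y\<close> gives a finite extension of \<open>E\<close>.\<close>

lemma algebraic_trans:
  assumes E: "subfield E" and alg: "\<And>a. a \<in> A \<Longrightarrow> algebraic_over E a" and y: "algebraic_over A y"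
  shows "algebraic_over E y"
proof -
  obtain p where p: "p \<in> poly_over A" "p \<noteq> 0" "poly p y = 0" using y by (auto simp: algebraic_over_iff)
  have "range (coeff p) \<subseteq> A" using p by (auto simp: poly_over_def)
  then obtain L where L: "fin_ext E L" "range (coeff p) \<subseteq> L"
    using fin_ext_adjoin_finite[OF E finite_range_coeff, of p] alg by blast
  have "algebraic_over L y" using L p by (auto simp: algebraic_over_iff poly_over_def)
  then obtain L' where "fin_ext E L'" "y \<in> L'" using fin_ext_adjoin[OF E L(1)] by blast
  thus ?thesis using fin_ext_algebraic[OF E] by blast
qed

lemma subfield_algebraic_elements:
  assumes E: "subfield E" shows "subfield {y. algebraic_over E y}"
proof -
  have main: "\<exists>L. fin_ext E L \<and> x \<in> L \<and> y \<in> L"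
    if xy: "algebraic_over E x" "algebraic_over E y" for x y
    using fin_ext_adjoin_finite[OF E, of "{x, y}"] xy by auto
  have inE: "algebraic_over E a" if "a \<in> E" for a
    using fin_ext_algebraic[OF E fin_ext_self[OF E] that] .
  have sub: "subfield L" if "fin_ext E L" for L using that by (simp add: fin_ext_def)
  show ?thesis unfolding subfield_def mem_Collect_eq
  proof (intro conjI ballI)
    show "algebraic_over E 0" "algebraic_over E 1" using inE E by (auto intro: subfield_intros)
  next
    fix x y assume "x \<in> {y. algebraic_over E y}" "y \<in> {y. algebraic_over E y}"
    then obtain L where L: "fin_ext E L" "x \<in> L" "y \<in> L" using main by blast
    show "algebraic_over E (x + y)" "algebraic_over E (x * y)"
      using fin_ext_algebraic[OF E L(1)] sub[OF L(1)] L by (auto intro: subfield_intros)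
  next
    fix x assume "x \<in> {y. algebraic_over E y}"
    then obtain L where L: "fin_ext E L" "x \<in> L" using main by blast
    show "algebraic_over E (- x)" "algebraic_over E (inverse x)"
      using fin_ext_algebraic[OF E L(1)] sub[OF L(1)] L by (auto intro: subfield_intros)
  qed
qed

lemma algebraic_self: "subfield E \<Longrightarrow> a \<in> E \<Longrightarrow> algebraic_over E a"
  using fin_ext_algebraic fin_ext_self by blast

subsection \<open>Simple transcendental extensions\<close>

text \<open>For a subfield \<open>k\<close> this is \<open>k(x)\<close>: a denominator vanishing at
  \<open>x\<close> only contributes 0, by the convention for division by zero.\<close>

definition frac_field :: "'a::field set \<Rightarrow> 'a \<Rightarrow> 'a set" where
  "frac_field k x = {poly f x / poly g x | f g. f \<in> poly_over k \<and> g \<in> poly_over k}"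

lemma frac_fieldE:
  assumes "subfield k" "z \<in> frac_field k x"
  obtains f g where "f \<in> poly_over k" "g \<in> poly_over k" "poly g x \<noteq> 0" "z = poly f x / poly g x"
proof -
  obtain f g where fg: "f \<in> poly_over k" "g \<in> poly_over k" "z = poly f x / poly g x"
    using assms by (auto simp: frac_field_def)
  show ?thesis
  proof (cases "poly g x = 0")
    case True
    then show ?thesis using that[of 0 1] fg assms poly_over_0 poly_over_1 by auto
  qed (use that fg in auto)
qed

lemma frac_fieldI:
  "f \<in> poly_over k \<Longrightarrow> g \<in> poly_over k \<Longrightarrow> z = poly f x / poly g x \<Longrightarrow> z \<in> frac_field k x"
  by (auto simp: frac_field_def)

lemma poly_in_frac_field: "subfield k \<Longrightarrow> f \<in> poly_over k \<Longrightarrow> poly f x \<in> frac_field k x"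
  by (rule frac_fieldI[of f _ 1]) (auto intro: poly_over_1)

lemma subset_frac_field: "subfield k \<Longrightarrow> k \<subseteq> frac_field k x"
  using poly_in_frac_field[of k "[:_:]" x] by (force intro: poly_over_intros)

lemma generator_in_frac_field: "subfield k \<Longrightarrow> x \<in> frac_field k x"
  using poly_in_frac_field[of k "[:0, 1:]" x] by (auto intro: poly_over_intros subfield_intros)

lemma subfield_frac_field:
  assumes k: "subfield k" shows "subfield (frac_field k x)"
proof -
  have add: "u + v \<in> frac_field k x" and mult: "u * v \<in> frac_field k x"
    if uv: "u \<in> frac_field k x" "v \<in> frac_field k x" for u v
  proof -
    obtain f g where fg: "f \<in> poly_over k" "g \<in> poly_over k" "poly g x \<noteq> 0" "u = poly f x / poly g x"
      using frac_fieldE[OF k uv(1)] .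
    obtain f' g' where fg': "f' \<in> poly_over k" "g' \<in> poly_over k" "poly g' x \<noteq> 0" "v = poly f' x / poly g' x"
      using frac_fieldE[OF k uv(2)] .
    show "u + v \<in> frac_field k x" using k fg fg'
      by (intro frac_fieldI[of "f * g' + f' * g" _ "g * g'"] poly_over_intros) (simp_all add: fg(4) fg'(4) add_frac_eq)
    show "u * v \<in> frac_field k x" using k fg fg'
      by (intro frac_fieldI[of "f * f'" _ "g * g'"] poly_over_intros) simp_all
  qed
  have "inverse u \<in> frac_field k x" if u: "u \<in> frac_field k x" for u
  proof -
    obtain f g where fg: "f \<in> poly_over k" "g \<in> poly_over k" "poly g x \<noteq> 0" "u = poly f x / poly g x"
      using frac_fieldE[OF k u] .
    thus ?thesis by (intro frac_fieldI[of g _ f]) simp_all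
  qed
  moreover have "- u \<in> frac_field k x" if "u \<in> frac_field k x" for u
    using mult[of "-1" u] that subset_frac_field[OF k, of x] subfield_1[OF k] subfield_minus[OF k] by auto
  ultimately show ?thesis
    using add mult subset_frac_field[OF k, of x] subfield_1[OF k] subfield_0[OF k]
    by (auto simp: subfield_def)
qed

lemma common_denominator:
  assumes k: "subfield k" and "finite I" and "\<And>i. i \<in> I \<Longrightarrow> z i \<in> frac_field k x"
  shows "\<exists>D\<in>poly_over k. poly D x \<noteq> 0 \<and> (\<forall>i\<in>I. \<exists>f\<in>poly_over k. poly D x * z i = poly f x)"
  using assms(2,3)
proof (induction I rule: finite_induct)
  case empty
  then show ?case using k by (intro bexI[of _ 1]) (auto intro: poly_over_1)
next
  case (insert j I)
  then obtain D where D: "D \<in> poly_over k" "poly D x \<noteq> 0"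
    "\<forall>i\<in>I. \<exists>f\<in>poly_over k. poly D x * z i = poly f x" by auto
  obtain f g where fg: "f \<in> poly_over k" "g \<in> poly_over k" "poly g x \<noteq> 0" "z j = poly f x / poly g x"
    using frac_fieldE[OF k insert.prems[of j]] by blast
  have "\<exists>h\<in>poly_over k. poly (D * g) x * z i = poly h x" if "i \<in> insert j I" for i
  proof (cases "i = j")
    case True
    have "poly (D * g) x * z i = poly (D * f) x" using fg(3) unfolding True fg(4) by simp
    thus ?thesis using poly_over_mult[OF k D(1) fg(1)] by blast
  next
    case False
    hence "i \<in> I" using that by simp
    from bspec[OF D(3) this] obtain h where h: "h \<in> poly_over k" "poly D x * z i = poly h x" ..
    have "poly (D * g) x * z i = poly (g * h) x" using h(2) by simp
    thus ?thesis using poly_over_mult[OF k fg(2) h(1)] by blast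
  qed
  moreover have "poly (D * g) x \<noteq> 0" using D(2) fg(3) by simp
  ultimately show ?case using poly_over_mult[OF k D(1) fg(2)] by blast
qed

subsection \<open>Minimal polynomials\<close>

lemma minimal_polynomial:
  assumes E: "subfield E" and y: "algebraic_over E y"
  obtains g where "g \<in> poly_over E" "g \<noteq> 0" "poly g y = 0"
    "\<And>h. h \<in> poly_over E \<Longrightarrow> poly h y = 0 \<Longrightarrow> \<exists>q\<in>poly_over E. h = g * q"
proof -
  let ?P = "\<lambda>p. p \<in> poly_over E \<and> p \<noteq> 0 \<and> poly p y = 0"
  have "\<exists>p. ?P p" using y by (auto simp: algebraic_over_iff)
  then obtain g where g: "?P g" and min: "\<And>q. ?P q \<Longrightarrow> degree g \<le> degree q"
    using exists_least_iff[of "\<lambda>n. \<exists>p. ?P p \<and> degree p = n"] by (metis linorder_not_le)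
  have "\<exists>q\<in>poly_over E. h = g * q" if h: "h \<in> poly_over E" "poly h y = 0" for h
  proof -
    have g1: "g \<in> poly_over E" and g2: "g \<noteq> 0" and g3: "poly g y = 0" using g by auto
    obtain q r where qr: "q \<in> poly_over E" "r \<in> poly_over E" "h = q * g + r"
      "r = 0 \<or> degree r < degree g" using poly_over_div_mod_exists[OF E g1 g2 h(1)] by blast
    have "poly r y = 0" using qr(3) h(2) g3 by simp
    hence "r = 0" using min[of r] qr(2,4) by (cases "r = 0") auto
    hence "h = g * q" using qr(3) by (simp add: mult.commute)
    thus ?thesis using qr(1) by blast
  qed
  thus ?thesis using that g by blast
qed

lemma root_positive_degree: "p \<noteq> 0 \<Longrightarrow> poly p y = 0 \<Longrightarrow> degree p > 0" for p :: "'a::field poly"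
  by (cases p) (auto split: if_splits)

lemma alg_closed_root:
  assumes "alg_closed_subfield (UNIV :: 'a::field set)" and "degree (p :: 'a poly) > 0"
  shows "\<exists>x. poly p x = 0"
proof -
  have "degree p \<ge> 1" using assms(2) by simp
  thus ?thesis using assms(1) unfolding alg_closed_subfield_def by blast
qed

lemma poly_with_single_root:
  fixes p :: "'a::field poly"
  assumes ac: "alg_closed_subfield (UNIV :: 'a set)" and "p \<noteq> 0" and "\<And>z. poly p z = 0 \<Longrightarrow> z = c"
  shows "p = smult (lead_coeff p) ([:-c, 1:] ^ degree p)"
  using assms(2,3)
proof (induction "degree p" arbitrary: p)
  case 0
  then obtain a where "p = [:a:]" by (metis degree_eq_zeroE)
  thus ?case by simp
next
  case (Suc n)
  obtain z where z: "poly p z = 0" using alg_closed_root[OF ac, of p] Suc.hyps by auto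
  hence "poly p c = 0" using Suc.prems(2)[OF z] by simp
  then obtain q where q: "p = [:-c, 1:] * q" by (auto simp: poly_eq_0_iff_dvd)
  have q0: "q \<noteq> 0" using q Suc.prems(1) by auto
  have dq: "degree p = Suc (degree q)" unfolding q using q0 by (subst degree_mult_eq) auto
  have "q = smult (lead_coeff q) ([:-c, 1:] ^ degree q)"
  proof (rule Suc.hyps(1))
    show "n = degree q" using dq Suc.hyps by simp
    show "z = c" if "poly q z = 0" for z using that Suc.prems(2)[of z] by (simp add: q)
  qed fact
  with q have "p = [:-c, 1:] * smult (lead_coeff q) ([:-c, 1:] ^ degree q)" by simp
  hence "p = smult (lead_coeff q) ([:-c, 1:] ^ Suc (degree q))" by (simp only: mult_smult_right power_Suc)
  moreover have "lead_coeff p = lead_coeff q" unfolding q by (simp only: lead_coeff_mult) simp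
  ultimately show ?case unfolding dq by metis
qed

text \<open>This coefficient recovers \<open>y ^ q\<close> from \<open>(X - y) ^ m\<close> whenever
  \<open>m'\<close> is invertible in the field.\<close>

lemma coeff_linear_power_char_exp:
  fixes y :: "'a::field"
  assumes m: "m = char_exp TYPE('a) ^ n * m'" and "m' > 0"
  shows "coeff ([:-y, 1:] ^ m) (m - char_exp TYPE('a) ^ n) = - (of_nat m' * y ^ (char_exp TYPE('a) ^ n))"
proof -
  let ?q = "char_exp TYPE('a) ^ n"
  have q: "?q \<le> m" using assms by simp
  have "coeff ([:-y, 1:] ^ m) (m - ?q) = of_nat (m choose (m - ?q)) * (- y) ^ ?q"
    using q by (simp add: coeff_linear_poly_power)
  also have "m choose (m - ?q) = m choose ?q" using q by (simp add: binomial_symmetric[symmetric])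
  finally show ?thesis using choose_char_exp[OF assms] by (simp add: minus_power_char_exp)
qed

subsection \<open>Extending isomorphisms to the algebraic closure\<close>

text \<open>Partial homomorphisms over \<open>E\<close> are represented by their graphs, which makes unions of
  chains immediate; injectivity is automatic because everything is algebraic over \<open>E\<close>.\<close>

definition hom_rel :: "'a::field set \<Rightarrow> ('a \<times> 'a) set \<Rightarrow> bool" where
  "hom_rel E R \<longleftrightarrow> (\<forall>c\<in>E. (c, c) \<in> R) \<and>
     (\<forall>a b c d. (a, b) \<in> R \<longrightarrow> (c, d) \<in> R \<longrightarrow> (a + c, b + d) \<in> R \<and> (a * c, b * d) \<in> R) \<and>
     (\<forall>b. (0, b) \<in> R \<longrightarrow> b = 0)"

definition poly_rel :: "('a::field \<times> 'a) set \<Rightarrow> ('a poly \<times> 'a poly) set" where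
  "poly_rel R = {(h, h'). \<forall>i. (coeff h i, coeff h' i) \<in> R}"

locale hom_relation =
  fixes E :: "'a::field set" and R
  assumes E: "subfield E" and alg: "\<And>y. algebraic_over E y" and R: "hom_rel E R"
begin

lemma base: "c \<in> E \<Longrightarrow> (c, c) \<in> R"
  and add: "(a, b) \<in> R \<Longrightarrow> (c, d) \<in> R \<Longrightarrow> (a + c, b + d) \<in> R"
  and mult: "(a, b) \<in> R \<Longrightarrow> (c, d) \<in> R \<Longrightarrow> (a * c, b * d) \<in> R"
  and zero: "(0, b) \<in> R \<Longrightarrow> b = 0"
  using R by (auto simp: hom_rel_def)

lemma one_zero: "(0, 0) \<in> R" "(1, 1) \<in> R"
  using base subfield_0[OF E] subfield_1[OF E] by auto

lemma minus: "(a, b) \<in> R \<Longrightarrow> (- a, - b) \<in> R"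
  using mult[OF base[OF subfield_minus[OF E subfield_1[OF E]]], of a b] by simp

lemma single_valued: "(a, b) \<in> R \<Longrightarrow> (a, b') \<in> R \<Longrightarrow> b = b'"
  using add[OF _ minus, of a b a b'] zero[of "b - b'"] by auto

lemma sum: "(\<And>i. i \<in> A \<Longrightarrow> (f i, g i) \<in> R) \<Longrightarrow> (sum f A, sum g A) \<in> R"
  by (induction A rule: infinite_finite_induct) (auto intro: add one_zero)

lemma power: "(a, b) \<in> R \<Longrightarrow> (a ^ n, b ^ n) \<in> R"
  by (induction n) (auto intro: mult one_zero)

lemma poly: "h \<in> poly_over E \<Longrightarrow> (a, b) \<in> R \<Longrightarrow> (poly h a, poly h b) \<in> R"
  unfolding poly_altdef by (intro sum mult power base) (auto intro: poly_over_coeff)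

lemma inverse_poly: obtains h where "h \<in> poly_over E" "inverse a = poly h a"
  using algebraic_inverse[OF E alg] by blast

text \<open>As \<open>inverse a\<close> is a polynomial in \<open>a\<close> over \<open>E\<close>, a
  pair \<open>(a, 0)\<close> with nonzero \<open>a\<close> would put \<open>(1, 0)\<close> into
  \<open>R\<close>.\<close>

lemma zero_converse: assumes "(a, 0) \<in> R" shows "a = 0"
proof (rule ccontr)
  assume a: "a \<noteq> 0"
  obtain h where h: "h \<in> poly_over E" "inverse a = poly h a" by (rule inverse_poly)
  have "(a * poly h a, 0 * poly h 0) \<in> R" by (intro mult poly h assms)
  hence "(1, 0) \<in> R" using a unfolding h(2)[symmetric] by simp
  thus False using single_valued[OF one_zero(2), of 0] by simp
qed

lemma Domain_subfield: "subfield (Domain R)"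
proof -
  have "inverse a \<in> Domain R" if ab: "(a, b) \<in> R" for a b
  proof -
    obtain h where h: "h \<in> poly_over E" "inverse a = poly h a" by (rule inverse_poly)
    show ?thesis using poly[OF h(1) ab] unfolding h(2) by blast
  qed
  note inv = this
  show ?thesis unfolding subfield_def
  proof (intro conjI ballI)
    show "0 \<in> Domain R" "1 \<in> Domain R" using one_zero by auto
  next
    fix x y assume "x \<in> Domain R" "y \<in> Domain R"
    then obtain u v where "(x, u) \<in> R" "(y, v) \<in> R" by (auto simp: Domain_iff)
    from add[OF this] mult[OF this] show "x + y \<in> Domain R" "x * y \<in> Domain R" by auto
  next
    fix x assume "x \<in> Domain R"
    then obtain u where u: "(x, u) \<in> R" by (auto simp: Domain_iff)
    show "- x \<in> Domain R" "inverse x \<in> Domain R" using minus[OF u] inv[OF u] by auto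
  qed
qed

lemma poly_rel_mult:
  "(f, f') \<in> poly_rel R \<Longrightarrow> (g, g') \<in> poly_rel R \<Longrightarrow> (f * g, f' * g') \<in> poly_rel R"
  by (auto simp: poly_rel_def coeff_mult intro!: sum mult)

lemma poly_rel_add:
  "(f, f') \<in> poly_rel R \<Longrightarrow> (g, g') \<in> poly_rel R \<Longrightarrow> (f + g, f' + g') \<in> poly_rel R"
  by (auto simp: poly_rel_def intro!: add)

lemma poly_rel_const: "(a, b) \<in> R \<Longrightarrow> ([:a:], [:b:]) \<in> poly_rel R"
  by (auto simp: poly_rel_def coeff_pCons one_zero split: nat.splits)

lemma poly_rel_total:
  assumes "h \<in> poly_over (Domain R)" obtains h' where "(h, h') \<in> poly_rel R"
proof -
  have "\<forall>i. \<exists>b. (coeff h i, b) \<in> R" using assms by (auto simp: poly_over_def Domain_iff)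
  then obtain c where c: "\<And>i. (coeff h i, c i) \<in> R" by metis
  have 0: "c i = 0" if "i > degree h" for i
    using c[of i] zero[of "c i"] that by (simp add: coeff_eq_0)
  define h' where "h' = (\<Sum>i\<le>degree h. monom (c i) i)"
  have "coeff h' i = c i" for i using 0[of i] by (auto simp: h'_def coeff_sum)
  thus ?thesis using that[of h'] c by (auto simp: poly_rel_def)
qed

lemma poly_rel_single_valued: "(h, f) \<in> poly_rel R \<Longrightarrow> (h, g) \<in> poly_rel R \<Longrightarrow> f = g"
  by (auto simp: poly_rel_def poly_eq_iff intro: single_valued)

text \<open>Related polynomials are evaluated at \<open>a\<close> and \<open>b\<close>. This is well
  defined: a polynomial vanishing at \<open>a\<close> is a multiple of \<open>g\<close>, so its
  partner is a multiple of \<open>g'\<close>, which vanishes at \<open>b\<close>.\<close>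

lemma adjoin:
  assumes g: "(g, g') \<in> poly_rel R" and b: "poly g' b = 0"
    and min: "\<And>h. h \<in> poly_over (Domain R) \<Longrightarrow> poly h a = 0 \<Longrightarrow> \<exists>q\<in>poly_over (Domain R). h = g * q"
  shows "\<exists>R'. hom_rel E R' \<and> R \<subseteq> R' \<and> (a, b) \<in> R'"
proof -
  define R' where "R' = (\<lambda>(h, h'). (poly h a, poly h' b)) ` poly_rel R"
  have R'I: "(u, v) \<in> R'" if "(h, h') \<in> poly_rel R" "u = poly h a" "v = poly h' b" for u v h h'
    unfolding R'_def using that by (intro image_eqI[of _ _ "(h, h')"]) auto
  have sub: "R \<subseteq> R'"
    by (auto intro!: R'I poly_rel_const)
  have ab: "(a, b) \<in> R'"
    by (rule R'I[of "[:0, 1:]" "[:0, 1:]"]) (auto simp: poly_rel_def coeff_pCons one_zero split: nat.splits)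
  have closed: "(u + w, v + z) \<in> R' \<and> (u * w, v * z) \<in> R'" if uv: "(u, v) \<in> R'" "(w, z) \<in> R'" for u v w z
  proof -
    obtain f f' h h' where "(f, f') \<in> poly_rel R" "u = poly f a" "v = poly f' b"
      "(h, h') \<in> poly_rel R" "w = poly h a" "z = poly h' b" using uv by (auto simp: R'_def)
    thus ?thesis
      using R'I[OF poly_rel_add, of f f' h h'] R'I[OF poly_rel_mult, of f f' h h'] by simp
  qed
  have "v = 0" if v: "(0, v) \<in> R'" for v
  proof -
    obtain h h' where h: "(h, h') \<in> poly_rel R" "poly h a = 0" "v = poly h' b" using v by (auto simp: R'_def)
    have "h \<in> poly_over (Domain R)" using h(1) by (auto simp: poly_rel_def poly_over_def)
    then obtain q where q: "q \<in> poly_over (Domain R)" "h = g * q" using min h(2) by blast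
    obtain q' where q': "(q, q') \<in> poly_rel R" using poly_rel_total[OF q(1)] .
    have "h' = g' * q'" using poly_rel_single_valued[OF h(1)] poly_rel_mult[OF g q'] q(2) by simp
    thus ?thesis using h(3) b by simp
  qed
  hence "hom_rel E R'" unfolding hom_rel_def using closed sub base by blast
  thus ?thesis using sub ab by blast
qed

end

lemma hom_rel_Union:
  assumes "C \<noteq> {}" and C: "\<And>R. R \<in> C \<Longrightarrow> hom_rel E R"
    and chain: "\<And>R S. R \<in> C \<Longrightarrow> S \<in> C \<Longrightarrow> R \<subseteq> S \<or> S \<subseteq> R"
  shows "hom_rel E (\<Union>C)"
  unfolding hom_rel_def
proof (intro conjI ballI allI impI)
  fix c assume "c \<in> E"
  obtain R where "R \<in> C" using \<open>C \<noteq> {}\<close> by blast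
  thus "(c, c) \<in> \<Union>C" using C[of R] \<open>c \<in> E\<close> by (auto simp: hom_rel_def)
next
  fix a b c d assume "(a, b) \<in> \<Union>C" "(c, d) \<in> \<Union>C"
  then obtain R S where RS: "R \<in> C" "S \<in> C" "(a, b) \<in> R" "(c, d) \<in> S" by blast
  then obtain T where T: "T \<in> C" "(a, b) \<in> T" "(c, d) \<in> T" using chain[OF RS(1,2)] by blast
  have "(a + c, b + d) \<in> T" "(a * c, b * d) \<in> T" using C[OF T(1)] T(2,3) unfolding hom_rel_def by blast+
  thus "(a + c, b + d) \<in> \<Union>C" "(a * c, b * d) \<in> \<Union>C" using T(1) by blast+
next
  fix b assume "(0, b) \<in> \<Union>C"
  thus "b = 0" using C by (auto simp: hom_rel_def)
qed

lemma total_hom_rel_Aut: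
  assumes E: "subfield E" and alg: "\<And>y. algebraic_over E y" and M: "hom_rel E M" "Domain M = UNIV"
  obtains \<tau> where "\<tau> \<in> Aut_over E" "\<And>a. (a, \<tau> a) \<in> M"
proof -
  interpret M: hom_relation E M by unfold_locales (use E alg M in auto)
  have "\<forall>a. \<exists>b. (a, b) \<in> M" using M(2) by blast
  then obtain \<tau> where \<tau>: "\<And>a. (a, \<tau> a) \<in> M" by metis
  have eq: "\<tau> a = b" if "(a, b) \<in> M" for a b using M.single_valued[OF \<tau> that] .
  have \<tau>_add: "\<tau> (a + b) = \<tau> a + \<tau> b" and \<tau>_mult: "\<tau> (a * b) = \<tau> a * \<tau> b" for a b
    using eq M.add[OF \<tau> \<tau>] M.mult[OF \<tau> \<tau>] by auto
  have \<tau>E: "\<tau> c = c" if "c \<in> E" for c using eq M.base[OF that] .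
  have inj: "inj \<tau>"
  proof (rule injI)
    fix a b assume "\<tau> a = \<tau> b"
    hence "(a + - b, 0) \<in> M" using M.add[OF \<tau>[of a] M.minus[OF \<tau>[of b]]] by simp
    thus "a = b" using M.zero_converse by fastforce
  qed
  have "surj \<tau>"
    unfolding surj_def
  proof
    fix b
    \<comment> \<open>Surjectivity: an injective homomorphism over \<open>E\<close> permutes the
      finite root set of a polynomial over \<open>E\<close> that annihilates
      \<open>b\<close>.\<close>
    obtain f where f: "f \<in> poly_over E" "f \<noteq> 0" "poly f b = 0" using alg[of b] by (auto simp: algebraic_over_iff)
    let ?Z = "{z. poly f z = 0}"
    have fin: "finite ?Z" using poly_roots_finite[OF f(2)] .
    have "\<tau> ` ?Z \<subseteq> ?Z"
    proof safe
      fix z assume "poly f z = 0"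
      hence "(0, poly f (\<tau> z)) \<in> M" using M.poly[OF f(1) \<tau>[of z]] by simp
      thus "poly f (\<tau> z) = 0" using M.zero by simp
    qed
    hence "\<tau> ` ?Z = ?Z" using fin inj by (intro endo_inj_surj) (auto intro: inj_on_subset)
    thus "\<exists>x. b = \<tau> x" using f(3) by blast
  qed
  hence "\<tau> \<in> Aut_over E" unfolding Aut_over_def field_iso_def bij_def
    using inj \<tau>_add \<tau>_mult \<tau>E subfield_1[OF E] by auto
  thus ?thesis using that \<tau> by blast
qed

text \<open>The homomorphism sending \<open>y\<close> to the root \<open>y'\<close> is extended by
  Zorn's lemma; a maximal extension is total because any missing element could still be
  adjoined.\<close>

lemma exists_Aut_over:
  fixes E :: "'a::field set"
  assumes E: "subfield E" and ac: "alg_closed_subfield (UNIV :: 'a set)" and alg: "\<And>y. algebraic_over E y"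
    and g: "g \<in> poly_over E" "poly g y' = 0"
      "\<And>h. h \<in> poly_over E \<Longrightarrow> poly h y = 0 \<Longrightarrow> \<exists>q\<in>poly_over E. h = g * q"
  shows "\<exists>\<tau>\<in>Aut_over E. \<tau> y = y'"
proof -
  have Id: "hom_rel E (Id_on E)" using E by (auto simp: hom_rel_def intro: subfield_intros)
  interpret I: hom_relation E "Id_on E" by unfold_locales (use E alg Id in auto)
  have "(g, g) \<in> poly_rel (Id_on E)" using g(1) by (auto simp: poly_rel_def poly_over_def)
  then obtain R0 where R0: "hom_rel E R0" "(y, y') \<in> R0"
    using I.adjoin[of g g y' y] g by auto
  define A where "A = {R. hom_rel E R \<and> R0 \<subseteq> R}"
  have "\<exists>M\<in>A. \<forall>X\<in>A. M \<subseteq> X \<longrightarrow> X = M"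
  proof (rule subset_Zorn_nonempty)
    show "A \<noteq> {}" using R0 by (auto simp: A_def)
  next
    fix C assume C: "C \<noteq> {}" "subset.chain A C"
    have "hom_rel E (\<Union>C)" using C by (intro hom_rel_Union) (auto simp: subset_chain_def A_def)
    moreover have "R0 \<subseteq> \<Union>C" using C unfolding subset_chain_def A_def by blast
    ultimately show "\<Union>C \<in> A" by (simp add: A_def)
  qed
  then obtain M where M: "M \<in> A" and max: "\<And>X. X \<in> A \<Longrightarrow> M \<subseteq> X \<Longrightarrow> X = M" by blast
  have hM: "hom_rel E M" and R0M: "R0 \<subseteq> M" using M by (auto simp: A_def)
  interpret M: hom_relation E M by unfold_locales (use E alg hM in auto)
  have "a \<in> Domain M" for a
  proof -
    have ED: "E \<subseteq> Domain M" using M.base by blast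
    have "algebraic_over (Domain M) a" using algebraic_over_mono[OF ED alg] .
    then obtain f where f: "f \<in> poly_over (Domain M)" "f \<noteq> 0" "poly f a = 0"
      "\<And>h. h \<in> poly_over (Domain M) \<Longrightarrow> poly h a = 0 \<Longrightarrow> \<exists>q\<in>poly_over (Domain M). h = f * q"
      using minimal_polynomial[OF M.Domain_subfield] by metis
    obtain f' where f': "(f, f') \<in> poly_rel M" using M.poly_rel_total[OF f(1)] .
    \<comment> \<open>The image of the minimal polynomial must have a root, so it must not become
      constant; its top coefficient survives because \<open>M\<close> sends only 0 to 0.\<close>
    have "coeff f' (degree f) \<noteq> 0"
    proof
      assume "coeff f' (degree f) = 0"
      hence "(lead_coeff f, 0) \<in> M" using f' unfolding poly_rel_def by (metis (mono_tags, lifting) case_prodD mem_Collect_eq)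
      thus False using M.zero_converse f(2) by force
    qed
    hence "degree f \<le> degree f'" by (rule le_degree)
    hence "degree f' > 0" using root_positive_degree[OF f(2,3)] by simp
    then obtain b where b: "poly f' b = 0" using alg_closed_root[OF ac] by blast
    obtain R' where R': "hom_rel E R'" "M \<subseteq> R'" "(a, b) \<in> R'" using M.adjoin[OF f' b f(4)] by blast
    have "R' = M" using R' R0M by (intro max) (auto simp: A_def)
    thus ?thesis using R'(3) by blast
  qed
  hence "Domain M = UNIV" by blast
  then obtain \<tau> where \<tau>: "\<tau> \<in> Aut_over E" "\<And>a. (a, \<tau> a) \<in> M"
    using total_hom_rel_Aut[OF E alg hM] by blast
  have "\<tau> y = y'" using M.single_valued[OF \<tau>(2)] R0(2) R0M by blast
  thus ?thesis using \<tau>(1) by blast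
qed

text \<open>Every root of the minimal polynomial is conjugate to \<open>y\<close>, so this
  polynomial is a constant times \<open>(X - y) ^ (q * m)\<close> with \<open>m\<close> invertible,
  and one of its coefficients yields \<open>y ^ q\<close>.\<close>

lemma fixed_field_purely_inseparable:
  fixes E :: "'a::field set"
  assumes E: "subfield E" and ac: "alg_closed_subfield (UNIV :: 'a set)" and alg: "\<And>y. algebraic_over E y"
    and fixed: "\<And>\<tau>. \<tau> \<in> Aut_over E \<Longrightarrow> \<tau> y = y"
  shows "\<exists>n. y ^ (char_exp TYPE('a) ^ n) \<in> E"
proof -
  obtain g where g: "g \<in> poly_over E" "g \<noteq> 0" "poly g y = 0"
    "\<And>h. h \<in> poly_over E \<Longrightarrow> poly h y = 0 \<Longrightarrow> \<exists>q\<in>poly_over E. h = g * q"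
    using minimal_polynomial[OF E alg[of y]] by metis
  have "z = y" if "poly g z = 0" for z
    using exists_Aut_over[OF E ac alg g(1) that g(4)] fixed by auto
  hence gy: "g = smult (lead_coeff g) ([:-y, 1:] ^ degree g)"
    by (intro poly_with_single_root[OF ac g(2)])
  obtain n m where nm: "degree g = char_exp TYPE('a) ^ n * m" "m > 0" "of_nat m \<noteq> (0::'a)"
    using char_exp_decomp[OF root_positive_degree[OF g(2,3)]] by blast
  let ?q = "char_exp TYPE('a) ^ n"
  have "coeff g (degree g - ?q) = lead_coeff g * coeff ([:-y, 1:] ^ degree g) (degree g - ?q)"
    by (subst gy) simp
  also have "\<dots> = - (lead_coeff g * of_nat m * y ^ ?q)"
    by (simp add: coeff_linear_power_char_exp[OF nm(1,2)])
  finally have "y ^ ?q = - coeff g (degree g - ?q) / (lead_coeff g * of_nat m)"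
    using nm(3) g(2) by (simp add: field_simps)
  also have "\<dots> \<in> E" using E g(1) by (intro subfield_divide subfield_minus subfield_mult subfield_of_nat) (auto intro: poly_over_coeff)
  finally show ?thesis by blast
qed

subsection \<open>Field homomorphisms given by rational functions\<close>

definition field_hom :: "('a::field \<Rightarrow> 'b::field) \<Rightarrow> bool" where
  "field_hom \<phi> \<longleftrightarrow> \<phi> 1 = 1 \<and> (\<forall>x y. \<phi> (x + y) = \<phi> x + \<phi> y \<and> \<phi> (x * y) = \<phi> x * \<phi> y)"

lemma
  assumes "field_hom \<phi>"
  shows field_hom_1: "\<phi> 1 = 1" and field_hom_add: "\<phi> (x + y) = \<phi> x + \<phi> y"
    and field_hom_mult: "\<phi> (x * y) = \<phi> x * \<phi> y"
  using assms by (auto simp: field_hom_def)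

lemma field_hom_0: "field_hom \<phi> \<Longrightarrow> \<phi> 0 = 0"
  using field_hom_add[of \<phi> 0 0] by (metis add.right_neutral add_left_cancel)

lemma field_hom_minus: "field_hom \<phi> \<Longrightarrow> \<phi> (- x) = - \<phi> x"
  using field_hom_add[of \<phi> x "- x"] field_hom_0[of \<phi>] by (simp add: eq_neg_iff_add_eq_0 add.commute)

lemma field_hom_diff: "field_hom \<phi> \<Longrightarrow> \<phi> (x - y) = \<phi> x - \<phi> y"
  using field_hom_add[of \<phi> x "- y"] by (simp add: field_hom_minus)

lemma field_hom_eq_0_iff: assumes "field_hom \<phi>" shows "\<phi> x = 0 \<longleftrightarrow> x = 0"
proof
  assume 0: "\<phi> x = 0"
  show "x = 0"
  proof (rule ccontr)
    assume "x \<noteq> 0"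
    hence "\<phi> x * \<phi> (inverse x) = 1"
      using field_hom_mult[OF assms, of x "inverse x"] field_hom_1[OF assms] by simp
    thus False using 0 by simp
  qed
qed (simp add: field_hom_0 assms)

lemma field_hom_inj: "field_hom \<phi> \<Longrightarrow> inj \<phi>"
  using field_hom_diff[of \<phi>] field_hom_eq_0_iff[of \<phi>] by (metis eq_iff_diff_eq_0 injI)

lemma field_hom_inverse: assumes "field_hom \<phi>" shows "\<phi> (inverse x) = inverse (\<phi> x)"
proof (cases "x = 0")
  case False
  hence "\<phi> x * \<phi> (inverse x) = 1"
    using field_hom_mult[OF assms, of x "inverse x"] field_hom_1[OF assms] by simp
  thus ?thesis by (metis inverse_unique)
qed (simp add: field_hom_0 assms)

lemma field_hom_power: "field_hom \<phi> \<Longrightarrow> \<phi> (x ^ n) = \<phi> x ^ n"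
  by (induction n) (auto simp: field_hom_1 field_hom_mult)

lemma field_hom_sum: "field_hom \<phi> \<Longrightarrow> \<phi> (sum f A) = (\<Sum>i\<in>A. \<phi> (f i))"
  by (induction A rule: infinite_finite_induct) (auto simp: field_hom_0 field_hom_add)

lemma field_hom_prod: "field_hom \<phi> \<Longrightarrow> \<phi> (prod f A) = (\<Prod>i\<in>A. \<phi> (f i))"
  by (induction A rule: infinite_finite_induct) (auto simp: field_hom_1 field_hom_mult)

lemma field_hom_poly:
  assumes "field_hom \<phi>" shows "\<phi> (poly p x) = poly (map_poly \<phi> p) (\<phi> x)"
  by (induction p) (auto simp: field_hom_0 field_hom_add field_hom_mult map_poly_pCons assms)

lemma field_hom_power_char_exp: "field_hom (\<lambda>x::'a::field. x ^ (char_exp TYPE('a) ^ n))"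
  by (auto simp: field_hom_def add_power_char_exp power_mult_distrib)

lemma field_hom_comp: "field_hom \<phi> \<Longrightarrow> field_hom \<psi> \<Longrightarrow> field_hom (\<lambda>x. \<psi> (\<phi> x))"
  by (auto simp: field_hom_def)

lemma poly_eq_0_if_infinite_roots:
  fixes p :: "'a::idom poly"
  assumes "infinite S" "\<And>s. s \<in> S \<Longrightarrow> poly p s = 0"
  shows "p = 0"
  using assms poly_roots_finite[of p] finite_subset[of S "{x. poly p x = 0}"] by blast

text \<open>A denominator of minimal degree is invariant under translations, hence constant, and
  multiplicativity then singles out one monomial.\<close>

lemma rational_field_hom:
  fixes \<phi> \<psi> :: "'a::field \<Rightarrow> 'a"
  assumes k: "subfield k" and inf: "infinite k" and \<phi>: "field_hom \<phi>" and \<psi>: "field_hom \<psi>"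
    and A: "A \<noteq> 0" and AB: "\<And>c. c \<in> k \<Longrightarrow> poly A (\<phi> c) * \<psi> c = poly B (\<phi> c)"
  shows "\<exists>n. \<forall>c\<in>k. \<psi> c = \<phi> c ^ (char_exp TYPE('a) ^ n)"
proof -
  have infS: "infinite (\<phi> ` k)"
    using inf field_hom_inj[OF \<phi>] by (meson finite_image_iff inj_on_subset subset_UNIV)
  note zeroI = poly_eq_0_if_infinite_roots[OF infS]
  let ?P = "\<lambda>A B. A \<noteq> 0 \<and> (\<forall>c\<in>k. poly A (\<phi> c) * \<psi> c = poly B (\<phi> c))"
  have "\<exists>A B. ?P A B" using A AB by blast
  then obtain A B where P: "?P A B" and min: "\<And>A' B'. ?P A' B' \<Longrightarrow> degree A \<le> degree A'"
    using exists_least_iff[of "\<lambda>n. \<exists>A B. ?P A B \<and> degree A = n"] by (metis linorder_not_le)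
  have AB: "poly A (\<phi> c) * \<psi> c = poly B (\<phi> c)" if "c \<in> k" for c using P that by blast
  have trans: "pcompose A [:\<phi> f, 1:] = A" if f: "f \<in> k" for f
  proof (rule ccontr)
    assume neq: "pcompose A [:\<phi> f, 1:] \<noteq> A"
    \<comment> \<open>Translating the argument by \<open>f\<close> and subtracting the original
      identity gives another valid pair, in whose denominator the leading terms cancel.\<close>
    define A2 where "A2 = pcompose A [:\<phi> f, 1:]"
    define B2 where "B2 = pcompose B [:\<phi> f, 1:] - smult (\<psi> f) A2"
    have 2: "poly A2 (\<phi> c) * \<psi> c = poly B2 (\<phi> c)" if c: "c \<in> k" for c
    proof -
      have "poly A (\<phi> (f + c)) * \<psi> (f + c) = poly B (\<phi> (f + c))"
        by (intro AB subfield_add[OF k] f c)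
      thus ?thesis
        by (simp add: A2_def B2_def poly_pcompose field_hom_add[OF \<phi>] field_hom_add[OF \<psi>] algebra_simps)
    qed
    have "poly (A2 - A) (\<phi> c) * \<psi> c = poly (B2 - B) (\<phi> c)" if c: "c \<in> k" for c
      using 2[OF c] AB[OF c] by (simp add: algebra_simps)
    hence le: "degree A \<le> degree (A2 - A)" using neq by (intro min[of _ "B2 - B"]) (auto simp: A2_def)
    have d: "degree A2 = degree A" by (simp add: A2_def degree_pcompose)
    have l: "lead_coeff A2 = lead_coeff A" by (simp add: A2_def lead_coeff_comp)
    show False
    proof (cases "degree A = 0")
      case True
      then obtain a where "A = [:a:]" by (metis degree_eq_zeroE)
      thus False using neq by simp
    next
      case False
      have "degree (A2 - A) < degree A"
        using d l False degree_diff_le[of A2 "degree A" A]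
        by (metis coeff_diff degree_0 eq_iff_diff_eq_0 le_refl leading_coeff_0_iff nat_less_le neq0_conv)
      thus False using le by simp
    qed
  qed
  \<comment> \<open>Invariance under infinitely many translations makes \<open>A\<close> take the
    value \<open>poly A 0\<close> infinitely often.\<close>
  have "A - [:poly A 0:] = 0"
  proof (rule zeroI)
    fix s assume "s \<in> \<phi> ` k"
    then obtain f where f: "f \<in> k" "s = \<phi> f" by blast
    have "poly A s = poly (pcompose A [:\<phi> f, 1:]) 0" by (simp add: poly_pcompose f)
    thus "poly (A - [:poly A 0:]) s = 0" using trans[OF f(1)] by simp
  qed
  then obtain a where a: "A = [:a:]" by (metis eq_iff_diff_eq_0)
  hence a0: "a \<noteq> 0" using P by auto
  define C where "C = smult (inverse a) B"
  have C: "\<psi> c = poly C (\<phi> c)" if "c \<in> k" for c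
    using AB[OF that] a a0 by (simp add: C_def field_simps)
  have "poly C (\<phi> 1) = 1" using C[OF subfield_1[OF k]] field_hom_1[OF \<psi>] by simp
  hence "C \<noteq> 0" by auto
  \<comment> \<open>Multiplicativity will give \<open>C(\<phi> f * X) = \<psi> f * C(X)\<close>, and
    a single nonzero coefficient, at \<open>i\<close>, determines \<open>\<psi> f\<close>.\<close>
  then obtain i where i: "coeff C i \<noteq> 0" by (metis leading_coeff_0_iff)
  have \<psi>\<phi>: "\<psi> f = \<phi> f ^ i" if f: "f \<in> k" for f
  proof -
    have "pcompose C [:0, \<phi> f:] - smult (\<psi> f) C = 0"
    proof (rule zeroI)
      fix s assume "s \<in> \<phi> ` k"
      then obtain c where c: "c \<in> k" "s = \<phi> c" by blast
      have "poly C (\<phi> (c * f)) = \<psi> f * poly C (\<phi> c)"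
        using C[OF subfield_mult[OF k c(1) f]] C[OF c(1)] by (simp add: field_hom_mult[OF \<psi>] mult.commute)
      thus "poly (pcompose C [:0, \<phi> f:] - smult (\<psi> f) C) s = 0"
        by (simp add: poly_pcompose c field_hom_mult[OF \<phi>])
    qed
    hence "coeff (pcompose C [:0, \<phi> f:]) i = \<psi> f * coeff C i" by (metis coeff_smult eq_iff_diff_eq_0)
    thus ?thesis using i by (simp add: coeff_pcompose_linear)
  qed
  have "i \<noteq> 0" using \<psi>\<phi>[OF subfield_0[OF k]] field_hom_0[OF \<psi>] by (cases "i = 0") auto
  then obtain n m where nm: "i = char_exp TYPE('a) ^ n * m" "m > 0" "of_nat m \<noteq> (0::'a)"
    using char_exp_decomp[of i] by auto
  let ?q = "char_exp TYPE('a) ^ n"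
  have q: "?q \<noteq> 0" "?q \<le> i" using nm char_exp_pos[where 'a='a] by auto
  \<comment> \<open>Additivity at \<open>1\<close> and \<open>c\<close> becomes the identity
    \<open>(1 + X)^i = 1 + X^i\<close>, whose coefficient at \<open>?q\<close> rules out every
    exponent but \<open>?q\<close>.\<close>
  have "[:1, 1:] ^ i - 1 - monom 1 i = (0 :: 'a poly)"
  proof (rule zeroI)
    fix s assume "s \<in> \<phi> ` k"
    then obtain c where c: "c \<in> k" "s = \<phi> c" by blast
    have "(1 + \<phi> c) ^ i = 1 + \<phi> c ^ i"
      using \<psi>\<phi>[OF subfield_add[OF k subfield_1[OF k] c(1)]] \<psi>\<phi>[OF c(1)]
      by (simp add: field_hom_add[OF \<phi>] field_hom_add[OF \<psi>] field_hom_1[OF \<phi>] field_hom_1[OF \<psi>])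
    thus "poly ([:1, 1:] ^ i - 1 - monom 1 i) s = 0" by (simp add: c poly_monom)
  qed
  hence "coeff ([:1, 1:] ^ i) ?q = coeff (1 + monom 1 i) ?q + (0::'a)"
    by (metis add.right_neutral diff_diff_add eq_iff_diff_eq_0)
  also have "coeff ([:1, 1:] ^ i) ?q = (of_nat (i choose ?q) :: 'a)"
    using q(2) by (simp add: coeff_linear_poly_power)
  also have "coeff (1 + monom 1 i) ?q + 0 = (if i = ?q then 1 else 0 :: 'a)"
    using q(1) by (cases "?q") auto
  finally have "of_nat (i choose ?q) = (if i = ?q then 1 else 0 :: 'a)" .
  hence "i = ?q" using choose_char_exp[OF nm(1,2)] nm(3) by (auto split: if_splits)
  thus ?thesis using \<psi>\<phi> by metis
qed

subsection \<open>Roots of unity\<close>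

text \<open>A root of \<open>1 + X + ... + X^(l - 1)\<close> differs from 1, where that polynomial
  takes the nonzero value \<open>l\<close>.\<close>

lemma root_of_unity_exists:
  assumes ac: "alg_closed_subfield (UNIV :: 'a::field set)" and l: "prime l" "of_nat l \<noteq> (0::'a)"
  shows "\<exists>\<zeta>::'a. \<zeta> ^ l = 1 \<and> \<zeta> \<noteq> 1"
proof -
  define p :: "'a poly" where "p = (\<Sum>i<l. monom 1 i)"
  have l2: "l \<ge> 2" using prime_ge_2_nat[OF l(1)] .
  have co: "coeff p i = (if i < l then 1 else 0)" for i by (simp add: p_def coeff_sum)
  have "degree p \<ge> 1" using l2 by (intro le_degree) (simp add: co)
  then obtain \<zeta> where \<zeta>: "poly p \<zeta> = 0" using alg_closed_root[OF ac, of p] by auto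
  hence s: "(\<Sum>i<l. \<zeta> ^ i) = 0" by (simp add: p_def poly_sum poly_monom)
  have "\<zeta> ^ l - 1 = (\<zeta> - 1) * (\<Sum>i<l. \<zeta> ^ i)" by (rule power_diff_1_eq)
  moreover have "\<zeta> \<noteq> 1" using s l(2) by auto
  ultimately show ?thesis using s by auto
qed

lemma prime_order:
  fixes \<zeta> :: "'a::field"
  assumes l: "prime l" and z: "\<zeta> ^ l = 1" "\<zeta> \<noteq> 1"
  shows "\<zeta> ^ n = 1 \<longleftrightarrow> l dvd n"
proof
  assume n: "\<zeta> ^ n = 1"
  show "l dvd n"
  proof (rule ccontr)
    assume "\<not> l dvd n"
    then obtain x y where "n * x = Suc (l * y)" using bezout_prime[OF l] by blast
    hence "\<zeta> ^ (n * x) = \<zeta> * \<zeta> ^ (l * y)" by simp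
    thus False using n z by (simp add: power_mult)
  qed
qed (use z in \<open>auto simp: power_mult\<close>)

text \<open>The powers \<open>\<zeta> ^ i\<close> with \<open>i < l\<close> are distinct and so
  exhaust the at most \<open>l\<close> roots of \<open>X^l - 1\<close>.\<close>

lemma root_of_unity_is_power:
  fixes \<zeta> :: "'a::field"
  assumes l: "prime l" and z: "\<zeta> ^ l = 1" "\<zeta> \<noteq> 1" and "w ^ l = 1"
  shows "\<exists>i. w = \<zeta> ^ i"
proof -
  define p :: "'a poly" where "p = monom 1 l - 1"
  have l0: "l > 0" using prime_gt_0_nat[OF l] .
  have "coeff p l = 1" using l0 by (simp add: p_def)
  hence p0: "p \<noteq> 0" by auto
  have dp: "degree p \<le> l" unfolding p_def by (intro degree_diff_le degree_monom_le) simp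
  let ?Z = "{x. poly p x = 0}"
  have inj: "inj_on (\<lambda>i. \<zeta> ^ i) {..<l}"
  proof (rule linorder_inj_onI)
    fix i j assume ij: "i < j" "i \<in> {..<l}" "j \<in> {..<l}"
    show "\<zeta> ^ i \<noteq> \<zeta> ^ j"
    proof
      assume "\<zeta> ^ i = \<zeta> ^ j"
      also have "\<dots> = \<zeta> ^ i * \<zeta> ^ (j - i)" using ij by (simp flip: power_add)
      finally have "\<zeta> ^ (j - i) = 1" using z l0 by (cases "\<zeta> = 0") (auto simp: power_0_left)
      hence "l dvd (j - i)" using prime_order[OF l z] by blast
      thus False using ij by (auto dest: dvd_imp_le)
    qed
  qed auto
  have fin: "finite ?Z" using poly_roots_finite[OF p0] .
  have sub: "(\<lambda>i. \<zeta> ^ i) ` {..<l} \<subseteq> ?Z"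
  proof safe
    fix i
    have "(\<zeta> ^ i) ^ l = 1" using z by (metis mult.commute power_mult power_one)
    thus "poly p (\<zeta> ^ i) = 0" by (simp add: p_def poly_monom)
  qed
  have "card ?Z \<le> l" using card_poly_roots_bound[OF p0] dp by simp
  hence "(\<lambda>i. \<zeta> ^ i) ` {..<l} = ?Z"
    using fin sub card_image[OF inj] by (intro card_seteq) auto
  moreover have "w \<in> ?Z" using assms(4) by (simp add: p_def poly_monom)
  ultimately show ?thesis by blast
qed

text \<open>Field homomorphisms map this set into itself, and relatively algebraically closed
  subfields contain it: a source of constants whose images are again constants.\<close>

definition unity_roots :: "'a::field set" where
  "unity_roots = {z. \<exists>n>0. z ^ n = 1}"

lemma infinite_good_primes: "infinite {l. prime l \<and> of_nat l \<noteq> (0::'a::field)}"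
proof -
  have "{l. prime l \<and> of_nat l = (0::'a)} \<subseteq> {CHAR('a)}"
  proof safe
    fix l assume l: "prime l" "of_nat l = (0::'a)"
    have "CHAR('a) dvd l" using l(2) of_nat_eq_0_iff_char_dvd by blast
    thus "l = CHAR('a)" using l(1) CHAR_not_1' by (metis One_nat_def prime_nat_iff)
  qed
  hence "finite {l. prime l \<and> of_nat l = (0::'a)}" using finite_subset by blast
  note fin = this
  show ?thesis
  proof
    assume "finite {l. prime l \<and> of_nat l \<noteq> (0::'a)}"
    hence "finite ({l. prime l \<and> of_nat l \<noteq> (0::'a)} \<union> {l. prime l \<and> of_nat l = (0::'a)})"
      using fin by (rule finite_UnI)
    moreover have "{l::nat. prime l} \<subseteq> {l. prime l \<and> of_nat l \<noteq> (0::'a)} \<union> {l. prime l \<and> of_nat l = (0::'a)}"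
      by blast
    ultimately have "finite {l::nat. prime l}" by (rule rev_finite_subset)
    thus False using primes_infinite by simp
  qed
qed

lemma infinite_unity_roots:
  assumes ac: "alg_closed_subfield (UNIV :: 'a::field set)"
  shows "infinite (unity_roots :: 'a set)"
proof -
  let ?P = "{l. prime l \<and> of_nat l \<noteq> (0::'a)}"
  have "\<forall>l\<in>?P. \<exists>\<zeta>::'a. \<zeta> ^ l = 1 \<and> \<zeta> \<noteq> 1" using root_of_unity_exists[OF ac] by blast
  then obtain \<zeta> :: "nat \<Rightarrow> 'a" where \<zeta>: "\<And>l. l \<in> ?P \<Longrightarrow> \<zeta> l ^ l = 1 \<and> \<zeta> l \<noteq> 1" by metis
  have "inj_on \<zeta> ?P"
  proof (rule inj_onI)
    fix l m assume lm: "l \<in> ?P" "m \<in> ?P" "\<zeta> l = \<zeta> m"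
    have "\<zeta> l ^ m = 1" using \<zeta>[OF lm(2)] lm(3) by simp
    hence "l dvd m" using prime_order[of l "\<zeta> l"] \<zeta>[OF lm(1)] lm(1) by blast
    thus "l = m" using lm(1,2) primes_dvd_imp_eq by blast
  qed
  hence "infinite (\<zeta> ` ?P)" using infinite_good_primes finite_imageD by blast
  moreover have "\<zeta> ` ?P \<subseteq> unity_roots"
  proof safe
    fix l assume "prime l" "of_nat l \<noteq> (0::'a)"
    hence "\<zeta> l ^ l = 1" "l > 0" using \<zeta>[of l] prime_gt_0_nat by auto
    thus "\<zeta> l \<in> unity_roots" unfolding unity_roots_def by blast
  qed
  ultimately show ?thesis using finite_subset by blast
qed

subsection \<open>Relatively algebraically closed subfields of corank one\<close>

lemma subfield_Union_chain:
  assumes "C \<noteq> {}" and C: "\<And>E. E \<in> C \<Longrightarrow> subfield E"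
    and chain: "\<And>E E'. E \<in> C \<Longrightarrow> E' \<in> C \<Longrightarrow> E \<subseteq> E' \<or> E' \<subseteq> E"
  shows "subfield (\<Union>C)"
  unfolding subfield_def
proof (intro conjI ballI)
  obtain E where "E \<in> C" using assms(1) by blast
  thus "0 \<in> \<Union>C" "1 \<in> \<Union>C" using subfield_0[OF C] subfield_1[OF C] by blast+
next
  fix x y assume "x \<in> \<Union>C" "y \<in> \<Union>C"
  then obtain E E' where "E \<in> C" "E' \<in> C" "x \<in> E" "y \<in> E'" by blast
  then obtain T where T: "T \<in> C" "x \<in> T" "y \<in> T" using chain[of E E'] by blast
  show "x + y \<in> \<Union>C" "x * y \<in> \<Union>C"
    using subfield_add[OF C[OF T(1)] T(2,3)] subfield_mult[OF C[OF T(1)] T(2,3)] T(1) by blast+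
next
  fix x assume "x \<in> \<Union>C"
  then obtain T where T: "T \<in> C" "x \<in> T" by blast
  show "- x \<in> \<Union>C" "inverse x \<in> \<Union>C"
    using subfield_minus[OF C[OF T(1)] T(2)] subfield_inverse[OF C[OF T(1)] T(2)] T(1) by blast+
qed

text \<open>With denominators cleared, the relation for \<open>x\<close> over \<open>k(y)\<close> is
  bivariate and can be read as a relation for \<open>y\<close> over \<open>k(x)\<close>.\<close>

lemma algebraic_exchange:
  assumes k: "subfield k" and x: "\<not> algebraic_over k x" and xy: "algebraic_over (frac_field k y) x"
  shows "algebraic_over (frac_field k x) y"
proof -
  obtain p where p: "p \<in> poly_over (frac_field k y)" "p \<noteq> 0" "poly p x = 0"
    using xy by (auto simp: algebraic_over_iff)
  obtain D where D: "D \<in> poly_over k" "poly D y \<noteq> 0"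
    "\<forall>i\<in>{..degree p}. \<exists>f\<in>poly_over k. poly D y * coeff p i = poly f y"
    using common_denominator[OF k, of "{..degree p}" "coeff p" y] p(1) by (auto simp: poly_over_def)
  obtain f where f: "\<And>i. i \<le> degree p \<Longrightarrow> f i \<in> poly_over k"
    "\<And>i. i \<le> degree p \<Longrightarrow> poly D y * coeff p i = poly (f i) y"
    using bchoice[OF D(3)[unfolded Bex_def]] by auto
  define h where "h = (\<Sum>i\<le>degree p. smult (x ^ i) (f i))"
  have fx: "subfield (frac_field k x)" using subfield_frac_field[OF k] .
  have "h \<in> poly_over (frac_field k x)" unfolding h_def
    using f(1) poly_over_mono[OF subset_frac_field[OF k, of x]]
    by (intro poly_over_sum poly_over_smult subfield_power fx generator_in_frac_field k) auto
  moreover have "poly h y = 0"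
  proof -
    have "poly h y = (\<Sum>i\<le>degree p. poly (f i) y * x ^ i)"
      by (simp add: h_def poly_sum mult.commute)
    also have "\<dots> = (\<Sum>i\<le>degree p. poly D y * (coeff p i * x ^ i))"
      by (intro sum.cong) (auto simp flip: f(2))
    also have "\<dots> = poly D y * poly p x" by (simp add: poly_altdef sum_distrib_left)
    finally show ?thesis using p(3) by simp
  qed
  moreover have "h \<noteq> 0"
  proof
    assume h0: "h = 0"
    have "poly (f (degree p)) y \<noteq> 0" using f(2)[of "degree p"] D(2) p(2) by auto
    hence "f (degree p) \<noteq> 0" by auto
    then obtain j where j: "coeff (f (degree p)) j \<noteq> 0" by (metis leading_coeff_0_iff)
    \<comment> \<open>If \<open>h\<close> vanished, its coefficient of index \<open>j\<close> would
      be a nontrivial polynomial relation for \<open>x\<close> over \<open>k\<close>.\<close>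
    define r where "r = (\<Sum>i\<le>degree p. monom (coeff (f i) j) i)"
    have "r \<in> poly_over k" unfolding r_def using f(1)
      by (intro poly_over_sum poly_over_monom k) (auto intro: poly_over_coeff)
    moreover have "coeff r (degree p) \<noteq> 0" using j by (simp add: r_def coeff_sum)
    moreover have "poly r x = coeff h j"
      by (simp add: r_def h_def poly_sum poly_monom coeff_sum mult.commute)
    ultimately show False using x h0 unfolding algebraic_over_iff by (metis coeff_0)
  qed
  ultimately show ?thesis by (auto simp: algebraic_over_iff)
qed

text \<open>Maximality acts twice: \<open>x\<close> stays transcendental over the field of elements
  algebraic over \<open>k1\<close>, and adjoining any \<open>y\<close> outside \<open>k1\<close>
  makes \<open>x\<close> algebraic, whence exchange applies.\<close>

lemma maximal_subfield_transcendental: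
  assumes k: "subfield k" and x: "\<not> algebraic_over k x"
  obtains k1 where "subfield k1" "k \<subseteq> k1" "\<not> algebraic_over k1 x"
    "\<And>y. algebraic_over k1 y \<Longrightarrow> y \<in> k1" "\<And>y. algebraic_over (frac_field k1 x) y"
proof -
  define A where "A = {k1. subfield k1 \<and> k \<subseteq> k1 \<and> \<not> algebraic_over k1 x}"
  have "\<exists>M\<in>A. \<forall>X\<in>A. M \<subseteq> X \<longrightarrow> X = M"
  proof (rule subset_Zorn_nonempty)
    show "A \<noteq> {}" using k x by (auto simp: A_def)
  next
    fix C assume C: "C \<noteq> {}" "subset.chain A C"
    have CA: "C \<subseteq> A" using C by (simp add: subset_chain_def)
    have "subfield (\<Union>C)" using C by (intro subfield_Union_chain) (auto simp: subset_chain_def A_def)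
    moreover have "k \<subseteq> \<Union>C" using C CA unfolding A_def by blast
    moreover have "\<not> algebraic_over (\<Union>C) x"
    proof
      assume "algebraic_over (\<Union>C) x"
      then obtain p where p: "p \<in> poly_over (\<Union>C)" "p \<noteq> 0" "poly p x = 0" by (auto simp: algebraic_over_iff)
      have "range (coeff p) \<subseteq> \<Union>C" using p(1) by (auto simp: poly_over_def)
      then obtain E where E: "E \<in> C" "range (coeff p) \<subseteq> E"
        using finite_subset_Union_chain[OF finite_range_coeff _ C] by blast
      hence "algebraic_over E x" using p by (auto simp: algebraic_over_iff poly_over_def)
      thus False using E(1) CA by (auto simp: A_def)
    qed
    ultimately show "\<Union>C \<in> A" by (simp add: A_def)
  qed
  then obtain k1 where k1A: "k1 \<in> A" and max: "\<And>X. X \<in> A \<Longrightarrow> k1 \<subseteq> X \<Longrightarrow> X = k1" by blast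
  have k1: "subfield k1" "k \<subseteq> k1" "\<not> algebraic_over k1 x" using k1A by (auto simp: A_def)
  have closed: "y \<in> k1" if "algebraic_over k1 y" for y
  proof -
    let ?X = "{y. algebraic_over k1 y}"
    have sub: "k1 \<subseteq> ?X" using algebraic_self[OF k1(1)] by blast
    have "\<not> algebraic_over ?X x" using algebraic_trans[OF k1(1), of ?X x] k1(3) by blast
    hence "?X = k1" using sub k1 subfield_algebraic_elements[OF k1(1)] by (intro max) (auto simp: A_def)
    thus ?thesis using that by blast
  qed
  have "algebraic_over (frac_field k1 x) y" for y
  proof (cases "y \<in> k1")
    case True
    thus ?thesis using algebraic_self[OF subfield_frac_field[OF k1(1)]] subset_frac_field[OF k1(1)] by blast
  next
    case False
    hence "frac_field k1 y \<noteq> k1" using generator_in_frac_field[OF k1(1)] by blast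
    hence "frac_field k1 y \<notin> A" using max subset_frac_field[OF k1(1)] by blast
    hence "algebraic_over (frac_field k1 y) x"
      using subfield_frac_field[OF k1(1), of y] subset_frac_field[OF k1(1), of y] k1(2) unfolding A_def by blast
    thus ?thesis using algebraic_exchange[OF k1(1,3)] by blast
  qed
  thus ?thesis using that k1 closed by blast
qed

subsection \<open>Characteristic polynomials satisfying Kummer relations\<close>

lemma order_power:
  fixes p :: "'a::field poly"
  assumes "p \<noteq> 0" shows "order a (p ^ n) = n * order a p"
proof (induction n)
  case (Suc n)
  have "order a (p * p ^ n) = order a p + order a (p ^ n)"
    using assms by (intro order_mult) simp
  thus ?case using Suc by simp
qed simp

lemma order_linear_neg: "order a [:c, -1:] = (if a = c then 1 else 0)" for c :: "'a::field"
proof (cases "a = c")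
  case True
  have "[:c, -1:] = - [:-c, 1:]" by simp
  hence "order a [:c, -1:] = order c ([:-c, 1:] ^ 1)" using True by (metis order_uminus power_one_right)
  thus ?thesis using True by (simp only: order_power_n_n) simp
qed (auto intro: order_0I)

lemma good_prime_not_dvd_char_exp_power:
  assumes "prime l" "of_nat l \<noteq> (0::'a::field)"
  shows "\<not> l dvd char_exp TYPE('a) ^ t"
proof
  assume "l dvd char_exp TYPE('a) ^ t"
  hence l: "l dvd char_exp TYPE('a)" using assms(1) prime_dvd_power by blast
  show False
  proof (cases "CHAR('a) = 0")
    case True
    thus False using l assms(1) by (simp add: char_exp_def)
  next
    case False
    hence "l dvd CHAR('a)" using l by (simp add: char_exp_def)
    hence "l = CHAR('a)" using primes_dvd_imp_eq[OF assms(1) prime_CHAR_field[OF False]] by blast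
    thus False using assms(2) by simp
  qed
qed

lemma good_prime_above: "\<exists>l>N. prime l \<and> of_nat l \<noteq> (0::'a::field)"
  using infinite_good_primes[where 'a='a] unfolding infinite_nat_iff_unbounded by blast

text \<open>In the application \<open>\<chi>\<close> is the characteristic polynomial of a Frobenius power of \<open>\<rho> x\<close>
  over \<open>k1(x)\<close>, \<open>\<theta>\<close> is \<open>\<rho>\<close> followed by that power, and \<open>kummer\<close> is the norm of the Kummer relation.\<close>

locale kummer_relation =
  fixes k1 k2 :: "'a::field set" and x y :: 'a and \<chi> :: "'a poly" and \<theta> :: "'a \<Rightarrow> 'a" and n :: nat
  assumes ac: "alg_closed_subfield (UNIV :: 'a set)"
    and k1: "subfield k1" and trans: "\<not> algebraic_over k1 x"
    and closed: "\<And>z. algebraic_over k1 z \<Longrightarrow> z \<in> k1"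
    and k2: "subfield k2" "infinite k2" "k2 \<subseteq> k1" "\<theta> ` k2 \<subseteq> k1"
    and \<theta>: "field_hom \<theta>"
    and \<chi>: "\<chi> \<in> poly_over (frac_field k1 x)" "poly \<chi> y = 0"
    and y: "y \<in> k1 \<Longrightarrow> c \<in> k2 \<Longrightarrow> poly \<chi> (\<theta> c) \<in> k1"
    and n: "n > 0"
    and kummer: "c \<in> k2 \<Longrightarrow> prime l \<Longrightarrow> of_nat l \<noteq> (0::'a) \<Longrightarrow>
      \<exists>e t v. \<not> l dvd e \<and> v \<in> frac_field k1 x \<and> v \<noteq> 0 \<and>
        poly \<chi> (\<theta> c) ^ (char_exp TYPE('a) ^ t) = (c - x) ^ (n * e) * v ^ l"
begin

text \<open>Converts relations between values at \<open>x\<close> into polynomial identities,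
  because \<open>x\<close> is transcendental over \<open>k1\<close>.\<close>

lemma poly_eqI_at_x:
  assumes "p \<in> poly_over k1" "q \<in> poly_over k1" "poly p x = poly q x" shows "p = q"
proof (rule ccontr)
  assume "p \<noteq> q"
  moreover have "p - q \<in> poly_over k1" using assms k1 by (intro poly_over_diff)
  ultimately have "algebraic_over k1 x" unfolding algebraic_over_iff using assms(3)
    by (intro bexI[of _ "p - q"]) auto
  thus False using trans by blast
qed

lemma x_notin: "x \<notin> k1"
  using trans algebraic_self[OF k1] by blast

text \<open>\<open>D(x)\<close> is a common denominator of the coefficients of
  \<open>\<chi>\<close>, so \<open>D(x) * \<chi>(T)\<close> is the value at \<open>X = x\<close> of
  a bivariate polynomial \<open>P(X, T)\<close> whose coefficient of \<open>T^i\<close> is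
  \<open>p i\<close>.\<close>

definition clears :: "'a poly \<Rightarrow> (nat \<Rightarrow> 'a poly) \<Rightarrow> bool" where
  "clears D p \<longleftrightarrow> D \<in> poly_over k1 \<and> D \<noteq> 0 \<and>
     (\<forall>i. p i \<in> poly_over k1 \<and> poly D x * coeff \<chi> i = poly (p i) x)"

lemma minimal_denominator:
  obtains D p where "clears D p" "\<And>D' p'. clears D' p' \<Longrightarrow> degree D \<le> degree D'"
proof -
  obtain D where D: "D \<in> poly_over k1" "poly D x \<noteq> 0"
    "\<forall>i\<in>{..degree \<chi>}. \<exists>f\<in>poly_over k1. poly D x * coeff \<chi> i = poly f x"
    using common_denominator[OF k1, of "{..degree \<chi>}" "coeff \<chi>" x] \<chi>(1) by (auto simp: poly_over_def)
  have "\<exists>f. f \<in> poly_over k1 \<and> poly D x * coeff \<chi> i = poly f x" for i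
  proof (cases "i \<le> degree \<chi>")
    case True
    thus ?thesis using bspec[OF D(3), of i] by auto
  next
    case False
    thus ?thesis using poly_over_0[OF k1] by (intro exI[of _ 0]) (simp add: coeff_eq_0)
  qed
  then obtain p where "\<And>i. p i \<in> poly_over k1 \<and> poly D x * coeff \<chi> i = poly (p i) x" by metis
  hence "clears D p" using D by (auto simp: clears_def)
  hence "\<exists>D p. clears D p" by blast
  then obtain D p where "clears D p" "\<And>D' p'. clears D' p' \<Longrightarrow> degree D \<le> degree D'"
    using exists_least_iff[of "\<lambda>n. \<exists>D p. clears D p \<and> degree D = n"] by (metis linorder_not_le)
  thus ?thesis using that by blast
qed

text \<open>In terms of the bivariate \<open>P\<close>, this is \<open>P(X, t)\<close>, with the
  variable standing for \<open>x\<close> kept free.\<close>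

definition specialize :: "(nat \<Rightarrow> 'a poly) \<Rightarrow> 'a \<Rightarrow> 'a poly" where
  "specialize p t = (\<Sum>i\<le>degree \<chi>. smult (t ^ i) (p i))"

context
  fixes D p assumes Dp: "clears D p"
begin

lemma D: "D \<in> poly_over k1" "D \<noteq> 0" "poly D x \<noteq> 0"
  and p: "\<And>i. p i \<in> poly_over k1" "\<And>i. poly D x * coeff \<chi> i = poly (p i) x"
  using Dp poly_eqI_at_x[of D 0] poly_over_0[OF k1] by (auto simp: clears_def)

lemma specialize_over: "t \<in> k1 \<Longrightarrow> specialize p t \<in> poly_over k1"
  unfolding specialize_def by (intro poly_over_sum poly_over_smult subfield_power k1 p)

lemma poly_specialize: "poly (specialize p t) x = poly D x * poly \<chi> t"
proof -
  have "poly (specialize p t) x = (\<Sum>i\<le>degree \<chi>. t ^ i * (poly D x * coeff \<chi> i))"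
    by (simp add: specialize_def poly_sum p(2))
  thus ?thesis by (simp add: poly_altdef sum_distrib_left mult_ac)
qed

lemma \<theta>_in: "c \<in> k2 \<Longrightarrow> \<theta> c \<in> k1" using k2(4) by blast

lemma chi_nonzero: assumes c: "c \<in> k2" shows "poly \<chi> (\<theta> c) \<noteq> 0"
proof -
  obtain l where l: "prime l" "of_nat l \<noteq> (0::'a)" using good_prime_above[of 0] by blast
  obtain e t v where "v \<noteq> 0"
    and eq: "poly \<chi> (\<theta> c) ^ (char_exp TYPE('a) ^ t) = (c - x) ^ (n * e) * v ^ l"
    using kummer[OF c l] by blast
  moreover have "c - x \<noteq> 0" using c k2(3) x_notin by auto
  ultimately have "poly \<chi> (\<theta> c) ^ (char_exp TYPE('a) ^ t) \<noteq> 0" by simp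
  thus ?thesis using char_exp_pos[where 'a='a] by (auto simp: power_0_left)
qed

lemma specialize_nonzero: "c \<in> k2 \<Longrightarrow> specialize p (\<theta> c) \<noteq> 0"
  using poly_specialize[of "\<theta> c"] chi_nonzero D(3) by auto

section \<open>Orders of zeros of the specialized polynomials\<close>

text \<open>As \<open>x\<close> is transcendental, the cleared Kummer relation is a polynomial
  identity, and orders at \<open>a\<close> can be compared. Here \<open>u\<close> and
  \<open>v\<close> are the orders of the denominator and numerator of the base of the
  \<open>l\<close>-th power.\<close>

lemma order_relation:
  assumes c: "c \<in> k2" and l: "prime l" "of_nat l \<noteq> (0::'a)"
  shows "\<exists>e t u v. \<not> l dvd e \<and> (\<forall>a. char_exp TYPE('a) ^ t * order a (specialize p (\<theta> c)) + l * u a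
    = char_exp TYPE('a) ^ t * order a D + (if a = c then n * e else 0) + l * v a)"
proof -
  obtain e t v where e: "\<not> l dvd e" and v: "v \<in> frac_field k1 x" "v \<noteq> 0"
    and eq: "poly \<chi> (\<theta> c) ^ (char_exp TYPE('a) ^ t) = (c - x) ^ (n * e) * v ^ l"
    using kummer[OF c l] by blast
  obtain f g where fg: "f \<in> poly_over k1" "g \<in> poly_over k1" "poly g x \<noteq> 0" "v = poly f x / poly g x"
    using frac_fieldE[OF k1 v(1)] .
  have nz: "f \<noteq> 0" "g \<noteq> 0" using fg v(2) by auto
  let ?q = "char_exp TYPE('a) ^ t" and ?S = "specialize p (\<theta> c)"
  have ck: "c \<in> k1" using c k2(3) by blast
  have "?S ^ ?q * g ^ l = D ^ ?q * [:c, -1:] ^ (n * e) * f ^ l"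
  proof (rule poly_eqI_at_x)
    show "?S ^ ?q * g ^ l \<in> poly_over k1"
      by (intro poly_over_mult poly_over_power k1 specialize_over \<theta>_in c fg)
    show "D ^ ?q * [:c, -1:] ^ (n * e) * f ^ l \<in> poly_over k1"
      by (intro poly_over_mult poly_over_power poly_over_pCons poly_over_0 k1 D fg ck subfield_minus subfield_1)
    have "poly (?S ^ ?q * g ^ l) x = poly D x ^ ?q * poly \<chi> (\<theta> c) ^ ?q * poly g x ^ l"
      by (simp add: poly_specialize power_mult_distrib)
    also have "\<dots> = poly D x ^ ?q * (c - x) ^ (n * e) * (v * poly g x) ^ l"
      by (simp only: eq power_mult_distrib mult_ac)
    also have "v * poly g x = poly f x" using fg(3,4) by simp
    finally show "poly (?S ^ ?q * g ^ l) x = poly (D ^ ?q * [:c, -1:] ^ (n * e) * f ^ l) x"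
      by simp
  qed
  moreover have S0: "?S \<noteq> 0" using specialize_nonzero[OF c] .
  have l1: "order a (?S ^ ?q * g ^ l) = ?q * order a ?S + l * order a g" for a
    using S0 nz by (subst order_mult) (auto simp: order_power)
  have l2: "order a (D ^ ?q * [:c, -1:] ^ (n * e) * f ^ l)
      = ?q * order a D + (if a = c then n * e else 0) + l * order a f" for a
  proof -
    have "order a (D ^ ?q * [:c, -1:] ^ (n * e) * f ^ l) = order a (D ^ ?q * [:c, -1:] ^ (n * e)) + order a (f ^ l)"
      using D(2) nz by (intro order_mult) auto
    also have "order a (D ^ ?q * [:c, -1:] ^ (n * e)) = order a (D ^ ?q) + order a ([:c, -1:] ^ (n * e))"
      using D(2) by (intro order_mult) auto
    finally show ?thesis using D(2) nz by (simp only: order_power order_linear_neg pCons_eq_0_iff) (auto simp: order_power order_linear_neg)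
  qed
  ultimately have "?q * order a ?S + l * order a g = ?q * order a D + (if a = c then n * e else 0) + l * order a f" for a
    by (metis l1 l2)
  thus ?thesis using e by (intro exI[of _ e] exI[of _ t] exI[of _ "\<lambda>a. order a g"] exI[of _ "\<lambda>a. order a f"]) auto
qed

text \<open>Every admissible prime \<open>l\<close> divides the difference of the two orders, since
  it does not divide a power of the characteristic exponent; a prime beyond its absolute value
  forces it to be zero.\<close>

lemma order_away:
  assumes c: "c \<in> k2" and "a \<noteq> c" shows "order a (specialize p (\<theta> c)) = order a D"
proof -
  let ?d = "int (order a (specialize p (\<theta> c))) - int (order a D)"
  obtain l where l: "l > nat \<bar>?d\<bar>" "prime l" "of_nat l \<noteq> (0::'a)" using good_prime_above by blast
  obtain t u v where "char_exp TYPE('a) ^ t * order a (specialize p (\<theta> c)) + l * u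
      = char_exp TYPE('a) ^ t * order a D + l * v"
  proof -
    obtain e t u v where "\<forall>a. char_exp TYPE('a) ^ t * order a (specialize p (\<theta> c)) + l * u a
      = char_exp TYPE('a) ^ t * order a D + (if a = c then n * e else 0) + l * v a"
      using order_relation[OF c l(2,3)] by blast
    from spec[OF this, of a] show ?thesis using that[of t "u a" "v a"] \<open>a \<noteq> c\<close> by simp
  qed
  hence "int (char_exp TYPE('a) ^ t * order a (specialize p (\<theta> c)) + l * u)
      = int (char_exp TYPE('a) ^ t * order a D + l * v)" by (rule arg_cong)
  hence "int (char_exp TYPE('a) ^ t) * ?d = int l * (int v - int u)"
    unfolding of_nat_add of_nat_mult by (simp add: right_diff_distrib)
  hence "int l dvd int (char_exp TYPE('a) ^ t) * ?d" by simp
  moreover have "prime (int l)" using l(2) by simp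
  moreover have "\<not> int l dvd int (char_exp TYPE('a) ^ t)"
    using good_prime_not_dvd_char_exp_power[OF l(2,3)] by (simp only: int_dvd_int_iff) simp
  ultimately have "int l dvd ?d" using prime_dvd_mult_iff by blast
  hence "?d = 0" using l(1) zdvd_imp_le[of "int l" "\<bar>?d\<bar>"] by (cases "?d = 0") (auto simp: dvd_abs_iff)
  thus ?thesis by simp
qed

text \<open>At \<open>c\<close> the factor \<open>c - x\<close> contributes \<open>n * e\<close>:
  equal orders would make \<open>l\<close> divide \<open>n * e\<close>, hence \<open>n\<close>,
  which is impossible for \<open>l > n\<close>.\<close>

lemma order_at: assumes c: "c \<in> k2" shows "order c (specialize p (\<theta> c)) \<noteq> order c D"
proof
  assume eq: "order c (specialize p (\<theta> c)) = order c D"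
  obtain l where l: "l > n" "prime l" "of_nat l \<noteq> (0::'a)" using good_prime_above by blast
  obtain e t u v where e: "\<not> l dvd e" and "\<forall>a. char_exp TYPE('a) ^ t * order a (specialize p (\<theta> c)) + l * u a
    = char_exp TYPE('a) ^ t * order a D + (if a = c then n * e else 0) + l * v a"
    using order_relation[OF c l(2,3)] by blast
  from spec[OF this(2), of c] have "l * u c = n * e + l * v c" unfolding eq by simp
  hence "l dvd n * e" by (metis dvd_add_left_iff dvd_triv_left)
  hence "l dvd n" using e l(2) prime_dvd_mult_iff by blast
  thus False using l(1) n by (auto dest: dvd_imp_le)
qed

lemma infinite_\<theta>: "infinite S \<Longrightarrow> infinite (\<theta> ` S)"
  using field_hom_inj[OF \<theta>] by (meson finite_image_iff inj_on_subset subset_UNIV)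

text \<open>A root of the denominator would be a common zero of all coefficients \<open>p i\<close>.\<close>

lemma reduce_denominator:
  assumes a: "poly D a = 0" obtains D' p' where "clears D' p'" "degree D' < degree D"
proof -
  have "algebraic_over k1 a" using D(1,2) a by (auto simp: algebraic_over_iff)
  hence ak: "a \<in> k1" by (rule closed)
  \<comment> \<open>\<open>r\<close> is \<open>P(a, T)\<close>. It vanishes at
    \<open>\<theta> c\<close> for every \<open>c\<close> in \<open>k2\<close> other than
    \<open>a\<close>, since the specialization has the same positive order at \<open>a\<close> as
    \<open>D\<close>.\<close>
  define r where "r = (\<Sum>i\<le>degree \<chi>. monom (poly (p i) a) i)"
  have "r = 0"
  proof (rule poly_eq_0_if_infinite_roots)
    show "infinite (\<theta> ` (k2 - {a}))" using k2(2) by (intro infinite_\<theta>) auto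
    fix s assume "s \<in> \<theta> ` (k2 - {a})"
    then obtain c where c: "c \<in> k2" "a \<noteq> c" "s = \<theta> c" by blast
    have "order a D \<noteq> 0" using a D(2) order_root by blast
    hence "order a (specialize p s) \<noteq> 0" using order_away[OF c(1,2)] c(3) by simp
    hence "poly (specialize p s) a = 0" using order_root by blast
    thus "poly r s = 0" by (simp add: r_def specialize_def poly_sum poly_monom mult.commute)
  qed
  moreover have "coeff r i = poly (p i) a" if "i \<le> degree \<chi>" for i
    using that by (simp add: r_def coeff_sum)
  moreover have "p i = 0" if "i > degree \<chi>" for i
  proof -
    have "poly (p i) x = 0" using that p(2)[of i] by (simp add: coeff_eq_0)
    thus ?thesis using poly_eqI_at_x[OF p(1) poly_over_0[OF k1]] by simp
  qed
  ultimately have "poly (p i) a = 0" for i by (cases "i \<le> degree \<chi>") auto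
  hence "\<forall>i. \<exists>q. p i = [:-a, 1:] * q" by (simp add: poly_eq_0_iff_dvd dvd_def)
  then obtain p' where p': "\<And>i. p i = [:-a, 1:] * p' i" by metis
  obtain D' where D': "D = [:-a, 1:] * D'" using a by (auto simp: poly_eq_0_iff_dvd)
  have lin: "[:-a, 1:] \<in> poly_over k1" "[:-a, 1:] \<noteq> 0"
    using k1 ak by (auto intro!: poly_over_pCons poly_over_0 subfield_minus subfield_1)
  have D'0: "D' \<noteq> 0" using D' D(2) by auto
  have "D' \<in> poly_over k1" using D(1) unfolding D' by (rule poly_over_factor[OF k1 lin])
  moreover have "p' i \<in> poly_over k1" for i using p(1)[of i] unfolding p' by (rule poly_over_factor[OF k1 lin])
  moreover have "poly D' x * coeff \<chi> i = poly (p' i) x" for i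
  proof -
    have "(x - a) * (poly D' x * coeff \<chi> i) = (x - a) * poly (p' i) x"
      using p(2)[of i] unfolding D' p' by (simp add: algebra_simps)
    moreover have "x - a \<noteq> 0" using ak x_notin by auto
    ultimately show ?thesis by simp
  qed
  ultimately have "clears D' p'" using D'0 by (simp add: clears_def)
  moreover have "degree D = Suc (degree D')" unfolding D' using D'0 by (subst degree_mult_eq) auto
  ultimately show ?thesis using that by simp
qed

end

text \<open>Once the denominator is constant, \<open>P(X, \<theta> c)\<close> has \<open>c\<close>
  as its only root, so its coefficients express a Frobenius power of \<open>c\<close> rationally in
  \<open>\<theta> c\<close>. The resulting factorization of \<open>\<chi>\<close> is then evaluated
  at \<open>y\<close>.\<close>

theorem power_relation:
  "\<exists>i j. x ^ (char_exp TYPE('a) ^ i) = y ^ (char_exp TYPE('a) ^ j) \<and>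
     (\<forall>c\<in>k2. c ^ (char_exp TYPE('a) ^ i) = \<theta> c ^ (char_exp TYPE('a) ^ j))"
proof -
  obtain D p where Dp: "clears D p" and min: "\<And>D' p'. clears D' p' \<Longrightarrow> degree D \<le> degree D'"
    by (rule minimal_denominator) blast
  have "degree D = 0"
  proof (rule ccontr)
    assume "degree D \<noteq> 0"
    then obtain a where a: "poly D a = 0" using alg_closed_root[OF ac, of D] by auto
    obtain D' p' where "clears D' p'" "degree D' < degree D" by (rule reduce_denominator[OF Dp a])
    thus False using min by fastforce
  qed
  then obtain \<delta> where \<delta>: "D = [:\<delta>:]" by (metis degree_eq_zeroE)
  have \<delta>0: "\<delta> \<noteq> 0" using D(2)[OF Dp] \<delta> by auto
  have ordD: "order a D = 0" for a using \<delta> \<delta>0 by (intro order_0I) simp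
  let ?S = "\<lambda>c. specialize p (\<theta> c)"
  have S0: "?S c \<noteq> 0" if "c \<in> k2" for c using specialize_nonzero[OF Dp that] .
  have root: "poly (?S c) a = 0 \<longleftrightarrow> a = c" if c: "c \<in> k2" for a c
  proof (cases "a = c")
    case True
    thus ?thesis using order_at[OF Dp c] ordD order_root by metis
  next
    case False
    thus ?thesis using order_away[OF Dp c False] ordD order_root S0[OF c] by metis
  qed
  \<comment> \<open>\<open>s j\<close> is the coefficient of \<open>X^j\<close> in \<open>P\<close>,
    viewed as a polynomial in \<open>T\<close>.\<close>
  define s where "s j = (\<Sum>i\<le>degree \<chi>. monom (coeff (p i) j) i)" for j
  have s_over: "s j \<in> poly_over k1" for j
    unfolding s_def by (intro poly_over_sum poly_over_monom k1 poly_over_coeff p[OF Dp])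
  have coeff_S: "coeff (specialize p t) j = poly (s j) t" for t j
    by (simp add: s_def specialize_def coeff_sum poly_sum poly_monom mult.commute)
  define J where "J = {j. s j \<noteq> 0}"
  have finJ: "finite J"
  proof (rule finite_subset)
    show "J \<subseteq> (\<Union>i\<le>degree \<chi>. {..degree (p i)})"
    proof
      fix j assume "j \<in> J"
      hence "(\<Sum>i\<le>degree \<chi>. monom (coeff (p i) j) i) \<noteq> 0" by (simp add: J_def s_def)
      then obtain i where i: "i \<in> {..degree \<chi>}" "monom (coeff (p i) j) i \<noteq> 0"
        by (rule sum.not_neutral_contains_not_neutral)
      hence "coeff (p i) j \<noteq> 0" by auto
      thus "j \<in> (\<Union>i\<le>degree \<chi>. {..degree (p i)})" using i(1) le_degree by blast
    qed
  qed simp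
  obtain c0 where c0: "c0 \<in> k2" using subfield_0[OF k2(1)] by blast
  have "J \<noteq> {}"
  proof
    assume "J = {}"
    hence "coeff (?S c0) j = 0" for j by (simp add: coeff_S J_def)
    hence "?S c0 = 0" by (intro poly_eqI) simp
    thus False using S0[OF c0] by simp
  qed
  define m where "m = Max J"
  have sm: "s m \<noteq> 0" using Max_in[OF finJ \<open>J \<noteq> {}\<close>] by (simp add: m_def J_def)
  have s_gt: "s j = 0" if "j > m" for j
    using Max_ge[OF finJ, of j] that by (auto simp: m_def J_def)
  \<comment> \<open>Where the leading coefficient does not vanish, the specialization has degree
    exactly \<open>m\<close> and is a multiple of \<open>(X - c)^m\<close>.\<close>
  define C where "C = {c\<in>k2. poly (s m) (\<theta> c) \<noteq> 0}"
  have infC: "infinite C"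
  proof
    assume "finite C"
    hence "infinite (k2 - C)" using k2(2) by simp
    hence "infinite (\<theta> ` (k2 - C))" by (rule infinite_\<theta>[OF Dp])
    hence "s m = 0" by (rule poly_eq_0_if_infinite_roots) (auto simp: C_def)
    thus False using sm by simp
  qed
  have S_C: "?S c = smult (poly (s m) (\<theta> c)) ([:-c, 1:] ^ m)" if c: "c \<in> C" for c
  proof -
    have ck: "c \<in> k2" and nz: "poly (s m) (\<theta> c) \<noteq> 0" using c by (auto simp: C_def)
    have "degree (?S c) = m"
    proof (rule antisym)
      show "degree (?S c) \<le> m" by (rule degree_le) (simp add: coeff_S s_gt)
      show "m \<le> degree (?S c)" using nz by (intro le_degree) (simp add: coeff_S)
    qed
    moreover have "?S c = smult (lead_coeff (?S c)) ([:-c, 1:] ^ degree (?S c))"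
      using root[OF ck] by (intro poly_with_single_root[OF ac S0[OF ck]]) simp
    ultimately show ?thesis by (simp only: coeff_S)
  qed
  have "m > 0"
  proof (rule ccontr)
    assume "\<not> m > 0"
    obtain c where c: "c \<in> C" using infC by (metis ex_in_conv finite.emptyI)
    hence ck: "c \<in> k2" by (simp add: C_def)
    have "?S c = [:poly (s m) (\<theta> c):]" using S_C[OF c] \<open>\<not> m > 0\<close> by simp
    hence "poly (?S c) c \<noteq> 0" using c by (simp add: C_def)
    thus False using root[OF ck] by simp
  qed
  then obtain i m' where m': "m = char_exp TYPE('a) ^ i * m'" "m' > 0" "of_nat m' \<noteq> (0::'a)"
    using char_exp_decomp by blast
  let ?q = "char_exp TYPE('a) ^ i"
  \<comment> \<open>The additional factor \<open>s m\<close> makes both sides vanish at parameters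
    outside \<open>C\<close>, so the identity holds on all of \<open>k2\<close>.\<close>
  define A where "A = smult (- of_nat m') (s m * s m)"
  define B where "B = s m * s (m - ?q)"
  have AB: "poly A (\<theta> c) * c ^ ?q = poly B (\<theta> c)" if c: "c \<in> k2" for c
  proof (cases "c \<in> C")
    case True
    have "poly (s (m - ?q)) (\<theta> c) = coeff (?S c) (m - ?q)" by (simp only: coeff_S)
    also have "\<dots> = poly (s m) (\<theta> c) * coeff ([:-c, 1:] ^ m) (m - ?q)"
      by (simp only: S_C[OF True] coeff_smult)
    also have "\<dots> = - (poly (s m) (\<theta> c) * (of_nat m' * c ^ ?q))"
      by (simp only: coeff_linear_power_char_exp[OF m'(1,2)] mult_minus_right)
    finally show ?thesis by (simp add: A_def B_def mult_ac)
  next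
    case False
    hence "poly (s m) (\<theta> c) = 0" using c by (simp add: C_def)
    thus ?thesis by (simp add: A_def B_def)
  qed
  have "A \<noteq> 0" using sm m'(3) by (simp add: A_def)
  then obtain j where j: "\<And>c. c \<in> k2 \<Longrightarrow> c ^ ?q = \<theta> c ^ (char_exp TYPE('a) ^ j)"
    using rational_field_hom[OF k2(1,2) \<theta> field_hom_power_char_exp _ AB] by blast
  let ?r = "char_exp TYPE('a) ^ j"
  \<comment> \<open>Both polynomials in \<open>T\<close> agree at infinitely many
    \<open>\<theta> c\<close>, hence identically, and in particular at the root \<open>y\<close> of
    \<open>\<chi>\<close>.\<close>
  have "smult (poly D x) \<chi> - s m * ([:x ^ ?q:] - monom 1 ?r) ^ m' = 0"
  proof (rule poly_eq_0_if_infinite_roots[OF infinite_\<theta>[OF Dp infC]])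
    fix t assume "t \<in> \<theta> ` C"
    then obtain c where c: "c \<in> C" "t = \<theta> c" by blast
    have ck: "c \<in> k2" using c by (simp add: C_def)
    have "poly D x * poly \<chi> t = poly (?S c) x" using c(2) by (simp add: poly_specialize[OF Dp])
    also have "\<dots> = poly (s m) t * (x - c) ^ m" by (simp add: S_C[OF c(1)] c(2))
    also have "(x - c) ^ m = ((x - c) ^ ?q) ^ m'" by (simp add: m'(1) power_mult)
    also have "(x - c) ^ ?q = x ^ ?q - t ^ ?r" by (simp add: diff_power_char_exp j[OF ck] c(2))
    finally show "poly (smult (poly D x) \<chi> - s m * ([:x ^ ?q:] - monom 1 ?r) ^ m') t = 0"
      by (simp add: poly_monom)
  qed
  hence "poly (smult (poly D x) \<chi> - s m * ([:x ^ ?q:] - monom 1 ?r) ^ m') y = 0" by (simp only: poly_0)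
  hence 0: "poly (s m) y * (x ^ ?q - y ^ ?r) ^ m' = 0" using \<chi>(2) by (simp add: poly_monom)
  \<comment> \<open>Otherwise \<open>y\<close> lies in \<open>k1\<close>, hence so does the value of
    \<open>\<chi>\<close> at \<open>\<theta> c0\<close>, and the nonzero specialization there would
    be constant although it vanishes at \<open>c0\<close>.\<close>
  have "poly (s m) y \<noteq> 0"
  proof
    assume "poly (s m) y = 0"
    hence "algebraic_over k1 y" using sm s_over by (auto simp: algebraic_over_iff)
    hence yk: "y \<in> k1" by (rule closed)
    have \<delta>k: "\<delta> \<in> k1" using poly_over_coeff[OF D(1)[OF Dp], of 0] by (simp add: \<delta>)
    define u where "u = \<delta> * poly \<chi> (\<theta> c0)"
    have uk: "u \<in> k1" unfolding u_def by (intro subfield_mult[OF k1] \<delta>k y yk c0)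
    have "?S c0 = [:u:]"
    proof (rule poly_eqI_at_x)
      show "?S c0 \<in> poly_over k1" by (intro specialize_over[OF Dp] \<theta>_in[OF Dp] c0)
      show "[:u:] \<in> poly_over k1" using uk k1 by (intro poly_over_pCons poly_over_0)
      show "poly (?S c0) x = poly [:u:] x" by (simp add: poly_specialize[OF Dp] u_def \<delta>)
    qed
    moreover have "poly (?S c0) c0 = 0" using root[OF c0] by simp
    ultimately show False using S0[OF c0] by simp
  qed
  hence "x ^ ?q = y ^ ?r" using 0 by simp
  thus ?thesis using j by blast
qed

end

subsection \<open>Norms and homomorphisms commuting with automorphism groups\<close>

lemma Aut_over_hom: "\<tau> \<in> Aut_over E \<Longrightarrow> field_hom \<tau>"
  by (auto simp: Aut_over_def field_iso_def field_hom_def)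

lemma Aut_over_fixes: "\<tau> \<in> Aut_over E \<Longrightarrow> c \<in> E \<Longrightarrow> \<tau> c = c"
  by (auto simp: Aut_over_def)

lemma Aut_over_bij: "\<tau> \<in> Aut_over E \<Longrightarrow> bij \<tau>"
  by (auto simp: Aut_over_def field_iso_def)

lemma Aut_overI:
  "field_hom \<tau> \<Longrightarrow> bij \<tau> \<Longrightarrow> (\<And>c. c \<in> E \<Longrightarrow> \<tau> c = c) \<Longrightarrow> \<tau> \<in> Aut_over E"
  by (auto simp: Aut_over_def field_iso_def field_hom_def)

lemma Aut_over_mono: "E \<subseteq> E' \<Longrightarrow> Aut_over E' \<subseteq> Aut_over E"
  by (auto simp: Aut_over_def)

lemma Aut_over_id: "(\<lambda>z. z) \<in> Aut_over E"
  by (intro Aut_overI) (auto simp: field_hom_def bij_def inj_def surj_def)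

lemma Aut_over_comp: "\<sigma> \<in> Aut_over E \<Longrightarrow> \<tau> \<in> Aut_over E \<Longrightarrow> \<sigma> \<circ> \<tau> \<in> Aut_over E"
  using field_hom_comp[OF Aut_over_hom Aut_over_hom, of \<tau> E \<sigma> E]
  by (intro Aut_overI) (auto simp: comp_def Aut_over_fixes intro: bij_comp[unfolded comp_def] Aut_over_bij)

lemma field_hom_inv: assumes "field_hom \<tau>" "bij \<tau>" shows "field_hom (inv \<tau>)"
proof -
  have inj: "inj \<tau>" and s: "\<And>z. \<tau> (inv \<tau> z) = z"
    using assms(2) by (auto simp: bij_def surj_f_inv_f)
  have "inv \<tau> 1 = 1" by (rule inv_f_eq[OF inj field_hom_1[OF assms(1)]])
  moreover have "inv \<tau> (u + v) = inv \<tau> u + inv \<tau> v" for u v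
    by (rule inv_f_eq[OF inj]) (simp add: field_hom_add[OF assms(1)] s)
  moreover have "inv \<tau> (u * v) = inv \<tau> u * inv \<tau> v" for u v
    by (rule inv_f_eq[OF inj]) (simp add: field_hom_mult[OF assms(1)] s)
  ultimately show ?thesis by (simp add: field_hom_def)
qed

lemma Aut_over_inv: assumes "\<tau> \<in> Aut_over E" shows "inv \<tau> \<in> Aut_over E"
proof (rule Aut_overI)
  show "field_hom (inv \<tau>)" using field_hom_inv[OF Aut_over_hom Aut_over_bij] assms by blast
  show "bij (inv \<tau>)" using Aut_over_bij[OF assms] by (rule bij_imp_bij_inv)
  show "inv \<tau> c = c" if "c \<in> E" for c
    using Aut_over_bij[OF assms] Aut_over_fixes[OF assms that] by (intro inv_f_eq) (auto simp: bij_def)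
qed

lemma Aut_over_poly:
  assumes "\<tau> \<in> Aut_over E" "g \<in> poly_over E" shows "\<tau> (poly g z) = poly g (\<tau> z)"
proof -
  note h = Aut_over_hom[OF assms(1)]
  have "\<tau> (poly g z) = (\<Sum>i\<le>degree g. \<tau> (coeff g i) * \<tau> z ^ i)"
    by (simp add: poly_altdef field_hom_sum[OF h] field_hom_mult[OF h] field_hom_power[OF h])
  also have "\<dots> = poly g (\<tau> z)"
    unfolding poly_altdef by (simp add: Aut_over_fixes[OF assms(1) poly_over_coeff[OF assms(2)]])
  finally show ?thesis .
qed

lemma map_poly_mult_hom: assumes "field_hom \<phi>" shows "map_poly \<phi> (p * q) = map_poly \<phi> p * map_poly \<phi> q"
  by (rule poly_eqI)
     (simp add: coeff_map_poly field_hom_0[OF assms] coeff_mult field_hom_sum[OF assms] field_hom_mult[OF assms])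

lemma map_poly_prod_linear:
  assumes "field_hom \<phi>"
  shows "map_poly \<phi> (\<Prod>i\<in>A. [:- f i, 1:]) = (\<Prod>i\<in>A. [:- \<phi> (f i), 1:])"
  by (induction A rule: infinite_finite_induct)
     (simp_all add: map_poly_mult_hom[OF assms] map_poly_pCons field_hom_0[OF assms] field_hom_1[OF assms]
       field_hom_minus[OF assms] one_pCons del: mult_pCons_left)

lemma finite_image_factor:
  assumes "finite (f ` A)" and "\<And>a b. a \<in> A \<Longrightarrow> b \<in> A \<Longrightarrow> f a = f b \<Longrightarrow> g a = g b"
  shows "finite (g ` A)"
proof (rule finite_surj[OF assms(1)])
  show "g ` A \<subseteq> (\<lambda>r. g (SOME a. a \<in> A \<and> f a = r)) ` (f ` A)"
  proof
    fix y assume "y \<in> g ` A"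
    then obtain a where a: "a \<in> A" "y = g a" by blast
    have "(SOME b. b \<in> A \<and> f b = f a) \<in> A \<and> f (SOME b. b \<in> A \<and> f b = f a) = f a"
      by (rule someI[of _ a]) (use a in simp)
    hence "g (SOME b. b \<in> A \<and> f b = f a) = y" using assms(2) a by metis
    thus "y \<in> (\<lambda>r. g (SOME a. a \<in> A \<and> f a = r)) ` (f ` A)" using a by blast
  qed
qed

lemma nth_root_exists:
  assumes "alg_closed_subfield (UNIV :: 'a::field set)" "l > 0" shows "\<exists>z::'a. z ^ l = u"
proof -
  have "coeff (monom 1 l - [:u:]) l = 1" using assms(2) by (cases l) auto
  hence "degree (monom 1 l - [:u:]) \<ge> l" by (intro le_degree) simp
  hence "degree (monom 1 l - [:u:]) > 0" using assms(2) by simp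
  from alg_closed_root[OF assms(1) this] show ?thesis by (auto simp: poly_monom)
qed

lemma algebraic_if_power:
  assumes E: "subfield E" and "n > 0" "z ^ n \<in> E" shows "algebraic_over E z"
proof -
  have "coeff (monom 1 n - [:z ^ n:]) n = 1" using assms(2) by (cases n) auto
  hence "monom 1 n - [:z ^ n:] \<noteq> 0" by (metis coeff_0 zero_neq_one)
  moreover have "monom 1 n - [:z ^ n:] \<in> poly_over E"
    by (intro poly_over_diff poly_over_monom poly_over_pCons poly_over_0 subfield_1 E assms)
  ultimately show ?thesis unfolding algebraic_over_iff
    by (intro bexI[of _ "monom 1 n - [:z ^ n:]"]) (simp_all add: poly_monom)
qed

text \<open>In the application \<open>L\<close> contains \<open>K\<close>, so
  \<open>Aut_over L\<close> is a subgroup of \<open>Aut_over K\<close> and commutation is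
  inherited.\<close>

locale commuting_hom =
  fixes k1 :: "'a::field set" and x :: 'a and L :: "'a set" and \<rho> :: "'a \<Rightarrow> 'a"
  assumes ac: "alg_closed_subfield (UNIV :: 'a set)"
    and k1: "subfield k1" and trans: "\<not> algebraic_over k1 x"
    and closed: "\<And>z. algebraic_over k1 z \<Longrightarrow> z \<in> k1"
    and alg: "\<And>z. algebraic_over (frac_field k1 x) z"
    and L: "fin_ext (frac_field k1 x) L"
    and \<rho>: "field_hom \<rho>" and comm: "\<And>\<tau> z. \<tau> \<in> Aut_over L \<Longrightarrow> \<rho> (\<tau> z) = \<tau> (\<rho> z)"
begin

abbreviation "E0 \<equiv> frac_field k1 x"

text \<open>The fixed field of \<open>Aut_over L\<close>, that is, the purely inseparable closure of
  \<open>L\<close>. It receives \<open>L\<close> under \<open>\<rho>\<close>.\<close>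

definition M where "M = {z. \<forall>\<tau>\<in>Aut_over L. \<tau> z = z}"

text \<open>Restriction identifies automorphisms that agree on \<open>M\<close>; this leaves a
  finite set of embeddings over which products can be formed.\<close>

definition conjugations where "conjugations = (\<lambda>\<tau>. restrict \<tau> M) ` Aut_over E0"

lemma E0: "subfield E0" by (rule subfield_frac_field[OF k1])
lemma k1_E0: "k1 \<subseteq> E0" by (rule subset_frac_field[OF k1])
lemma x_E0: "x \<in> E0" by (rule generator_in_frac_field[OF k1])
lemma E0_L: "E0 \<subseteq> L" using L by (simp add: fin_ext_def)
lemma M_fixes: "z \<in> M \<Longrightarrow> \<tau> \<in> Aut_over L \<Longrightarrow> \<tau> z = z"
  by (simp add: M_def)

lemma \<rho>_M: "z \<in> L \<Longrightarrow> \<rho> z \<in> M"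
  unfolding M_def by (auto simp flip: comm simp: Aut_over_fixes)

lemma conjugationE:
  assumes "\<omega> \<in> conjugations"
  obtains \<tau> where "\<tau> \<in> Aut_over E0" "\<omega> = restrict \<tau> M" "\<And>z. z \<in> M \<Longrightarrow> \<omega> z = \<tau> z"
  using assms unfolding conjugations_def by auto

text \<open>Automorphisms over \<open>E0\<close> send each spanning element to a root of a fixed
  polynomial. Two of them agreeing on \<open>B\<close> agree on \<open>L\<close>, so they differ by
  an element of \<open>Aut_over L\<close>, which is trivial on \<open>M\<close>.\<close>

lemma finite_conjugations: "finite conjugations"
proof -
  obtain B where B: "finite B" "L \<subseteq> span_over E0 B" using L by (auto simp: fin_ext_def)
  have "\<forall>b. \<exists>g. g \<in> poly_over E0 \<and> g \<noteq> 0 \<and> poly g b = 0" using alg by (auto simp: algebraic_over_iff)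
  then obtain g where g: "\<And>b. g b \<in> poly_over E0 \<and> g b \<noteq> 0 \<and> poly (g b) b = 0" by metis
  have "(\<lambda>\<tau>. restrict \<tau> B) ` Aut_over E0 \<subseteq> PiE B (\<lambda>b. {z. poly (g b) z = 0})"
  proof safe
    fix \<tau> b assume \<tau>: "\<tau> \<in> Aut_over E0" and "b \<in> B"
    have "poly (g b) (\<tau> b) = \<tau> (poly (g b) b)" using Aut_over_poly[OF \<tau>] g by metis
    also have "\<dots> = 0" using g[of b] field_hom_0[OF Aut_over_hom[OF \<tau>]] by simp
    finally show "poly (g b) (restrict \<tau> B b) = 0" using \<open>b \<in> B\<close> by simp
  qed auto
  moreover have "finite (PiE B (\<lambda>b. {z. poly (g b) z = 0}))"
    using B(1) g by (intro finite_PiE) (auto intro: poly_roots_finite)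
  ultimately have fin: "finite ((\<lambda>\<tau>. restrict \<tau> B) ` Aut_over E0)" by (rule finite_subset)
  show ?thesis unfolding conjugations_def
  proof (rule finite_image_factor[OF fin])
    fix \<sigma> \<tau> assume \<sigma>: "\<sigma> \<in> Aut_over E0" and \<tau>: "\<tau> \<in> Aut_over E0" and eq: "restrict \<sigma> B = restrict \<tau> B"
    have eqB: "\<sigma> b = \<tau> b" if "b \<in> B" for b using fun_cong[OF eq, of b] that by simp
    note hs = Aut_over_hom[OF \<sigma>] and ht = Aut_over_hom[OF \<tau>]
    have eqL: "\<sigma> z = \<tau> z" if zL: "z \<in> L" for z
    proof -
      obtain c where c: "\<forall>b\<in>B. c b \<in> E0" "z = (\<Sum>b\<in>B. c b * b)"
        using zL B(2) by (auto simp: span_over_def)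
      have "\<sigma> z = (\<Sum>b\<in>B. c b * \<sigma> b)" unfolding c(2) using c(1)
        by (simp add: field_hom_sum[OF hs] field_hom_mult[OF hs] Aut_over_fixes[OF \<sigma>])
      also have "\<dots> = (\<Sum>b\<in>B. c b * \<tau> b)" using eqB by simp
      also have "\<dots> = \<tau> z" unfolding c(2) using c(1)
        by (simp add: field_hom_sum[OF ht] field_hom_mult[OF ht] Aut_over_fixes[OF \<tau>])
      finally show ?thesis .
    qed
    have bt: "bij \<tau>" using Aut_over_bij[OF \<tau>] .
    have "inv \<tau> \<circ> \<sigma> \<in> Aut_over L"
    proof (rule Aut_overI)
      have "inv \<tau> \<circ> \<sigma> \<in> Aut_over E0" using Aut_over_comp[OF Aut_over_inv[OF \<tau>] \<sigma>] .
      thus "field_hom (inv \<tau> \<circ> \<sigma>)" "bij (inv \<tau> \<circ> \<sigma>)" using Aut_over_hom Aut_over_bij by blast+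
      show "(inv \<tau> \<circ> \<sigma>) z = z" if "z \<in> L" for z
        using eqL[OF that] bt by (simp add: bij_is_inj)
    qed
    hence "(inv \<tau> \<circ> \<sigma>) z = z" if "z \<in> M" for z using M_fixes[OF that] by blast
    hence "\<sigma> z = \<tau> z" if "z \<in> M" for z using that bt by (metis bij_inv_eq_iff comp_apply)
    thus "restrict \<sigma> M = restrict \<tau> M" by (auto simp: restrict_def)
  qed
qed

lemma conjugations_id: "restrict (\<lambda>z. z) M \<in> conjugations"
  unfolding conjugations_def by (intro imageI Aut_over_id)

lemma card_conjugations: "card conjugations > 0"
  using finite_conjugations conjugations_id by (auto simp: card_gt_0_iff)

lemma bij_conjugations:
  assumes \<sigma>: "\<sigma> \<in> Aut_over E0"
  shows "bij_betw (\<lambda>\<omega>. restrict (\<sigma> \<circ> \<omega>) M) conjugations conjugations"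
proof -
  let ?f = "\<lambda>\<omega>. restrict (\<sigma> \<circ> \<omega>) M"
  have inj: "inj_on ?f conjugations"
  proof (rule inj_onI)
    fix \<omega> \<omega>' assume o: "\<omega> \<in> conjugations" "\<omega>' \<in> conjugations" and eq: "?f \<omega> = ?f \<omega>'"
    have "\<omega> z = \<omega>' z" for z
    proof (cases "z \<in> M")
      case True
      hence "\<sigma> (\<omega> z) = \<sigma> (\<omega>' z)" using fun_cong[OF eq, of z] by simp
      thus ?thesis using Aut_over_bij[OF \<sigma>] by (metis bij_inv_eq_iff)
    next
      case False
      thus ?thesis using o by (auto simp: conjugations_def)
    qed
    thus "\<omega> = \<omega>'" by blast
  qed
  have "?f \<omega> \<in> conjugations" if \<omega>: "\<omega> \<in> conjugations" for \<omega>
  proof -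
    obtain \<tau> where \<tau>: "\<tau> \<in> Aut_over E0" "\<omega> = restrict \<tau> M" using conjugationE[OF \<omega>] by metis
    have "?f \<omega> = restrict (\<sigma> \<circ> \<tau>) M" by (auto simp: \<tau>(2) restrict_def)
    thus ?thesis unfolding conjugations_def using Aut_over_comp[OF \<sigma> \<tau>(1)] by blast
  qed
  hence "?f ` conjugations \<subseteq> conjugations" by blast
  hence "?f ` conjugations = conjugations" using inj finite_conjugations by (intro endo_inj_surj)
  thus ?thesis using inj by (simp add: bij_betw_def)
qed

lemma prod_conjugations:
  assumes "\<sigma> \<in> Aut_over E0" "z \<in> M"
  shows "(\<Prod>\<omega>\<in>conjugations. g (\<sigma> (\<omega> z))) = (\<Prod>\<omega>\<in>conjugations. g (\<omega> z))"
proof -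
  have "(\<Prod>\<omega>\<in>conjugations. g (\<sigma> (\<omega> z))) = (\<Prod>\<omega>\<in>conjugations. g ((restrict (\<sigma> \<circ> \<omega>) M) z))"
    using assms(2) by (intro prod.cong) auto
  also have "\<dots> = (\<Prod>\<omega>\<in>conjugations. g (\<omega> z))"
    by (rule prod.reindex_bij_betw[OF bij_conjugations[OF assms(1)]])
  finally show ?thesis .
qed

text \<open>A norm up to inseparability: for \<open>z\<close> in \<open>M\<close>,
  \<open>Aut_over E0\<close> permutes the factors, so some Frobenius power of the product lies in
  \<open>E0\<close>. The coefficients of \<open>char_poly_M\<close> behave alike.\<close>

definition norm_M where "norm_M z = (\<Prod>\<omega>\<in>conjugations. \<omega> z)"

definition char_poly_M where "char_poly_M z = (\<Prod>\<omega>\<in>conjugations. [:- \<omega> z, 1:])"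

lemma fixed_power_in_E0:
  assumes "\<And>\<sigma>. \<sigma> \<in> Aut_over E0 \<Longrightarrow> \<sigma> z = z"
  shows "\<exists>t. z ^ (char_exp TYPE('a) ^ t) \<in> E0"
  by (rule fixed_field_purely_inseparable[OF E0 ac alg]) (rule assms)

lemma norm_M_power_in_E0:
  assumes "z \<in> M" shows "\<exists>t. norm_M z ^ (char_exp TYPE('a) ^ t) \<in> E0"
proof (rule fixed_power_in_E0)
  fix \<sigma> assume \<sigma>: "\<sigma> \<in> Aut_over E0"
  have "\<sigma> (norm_M z) = (\<Prod>\<omega>\<in>conjugations. \<sigma> (\<omega> z))"
    by (simp add: norm_M_def field_hom_prod[OF Aut_over_hom[OF \<sigma>]])
  also have "\<dots> = norm_M z" unfolding norm_M_def using prod_conjugations[OF \<sigma> assms, of "\<lambda>u. u"] by simp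
  finally show "\<sigma> (norm_M z) = norm_M z" .
qed

lemma norm_M_nonzero: assumes "z \<in> M" "z \<noteq> 0" shows "norm_M z \<noteq> 0"
proof -
  have "\<omega> z \<noteq> 0" if \<omega>: "\<omega> \<in> conjugations" for \<omega>
  proof -
    obtain \<tau> where \<tau>: "\<tau> \<in> Aut_over E0" "\<omega> z = \<tau> z" using conjugationE[OF \<omega>] assms(1) by metis
    thus ?thesis using field_hom_eq_0_iff[OF Aut_over_hom[OF \<tau>(1)]] assms(2) by simp
  qed
  thus ?thesis unfolding norm_M_def using finite_conjugations by (simp add: prod_zero_iff)
qed

lemma char_poly_M_power_in_E0:
  assumes z: "z \<in> M" shows "\<exists>s. \<forall>i. coeff (char_poly_M z) i ^ (char_exp TYPE('a) ^ s) \<in> E0"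
proof -
  let ?P = "char_exp TYPE('a)"
  have "\<exists>t. coeff (char_poly_M z) i ^ (?P ^ t) \<in> E0" for i
  proof (rule fixed_power_in_E0)
    fix \<sigma> assume \<sigma>: "\<sigma> \<in> Aut_over E0"
    note h = Aut_over_hom[OF \<sigma>]
    have "map_poly \<sigma> (char_poly_M z) = (\<Prod>\<omega>\<in>conjugations. [:- \<sigma> (\<omega> z), 1:])"
      unfolding char_poly_M_def by (rule map_poly_prod_linear[OF h])
    also have "\<dots> = char_poly_M z"
      unfolding char_poly_M_def by (rule prod_conjugations[OF \<sigma> z])
    finally have "coeff (map_poly \<sigma> (char_poly_M z)) i = coeff (char_poly_M z) i" by simp
    thus "\<sigma> (coeff (char_poly_M z) i) = coeff (char_poly_M z) i"
      by (simp add: coeff_map_poly field_hom_0[OF h])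
  qed
  then obtain t where t: "\<And>i. coeff (char_poly_M z) i ^ (?P ^ t i) \<in> E0" by metis
  \<comment> \<open>The largest exponent among the finitely many relevant ones serves all
    coefficients at once; those beyond the degree are zero.\<close>
  define s where "s = Max (t ` {..degree (char_poly_M z)})"
  have "coeff (char_poly_M z) i ^ (?P ^ s) \<in> E0" for i
  proof (cases "i \<le> degree (char_poly_M z)")
    case True
    hence "t i \<le> s" unfolding s_def by (intro Max_ge) auto
    then obtain d where "s = t i + d" using le_Suc_ex by blast
    hence "coeff (char_poly_M z) i ^ (?P ^ s) = (coeff (char_poly_M z) i ^ (?P ^ t i)) ^ (?P ^ d)"
      by (simp add: power_add power_mult)
    thus ?thesis using subfield_power[OF E0 t] by simp
  next
    case False
    hence "coeff (char_poly_M z) i ^ (?P ^ s) = 0"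
      using char_exp_pos[where 'a='a] by (simp add: coeff_eq_0 power_0_left)
    thus ?thesis using subfield_0[OF E0] by (simp only:)
  qed
  thus ?thesis by blast
qed

section \<open>Kummer theory for the commuting homomorphism\<close>

text \<open>For an \<open>l\<close>-th root \<open>z\<close> of \<open>u\<close>, each
  \<open>\<tau>\<close> multiplies \<open>z\<close> by an \<open>l\<close>-th root of unity
  \<open>\<eta>\<close> and \<open>\<rho> z\<close> by \<open>\<rho> \<eta> = \<eta> ^ e\<close>, so
  \<open>\<rho> z / z ^ e\<close> is fixed. The same \<open>e\<close> serves every
  \<open>u\<close>.\<close>

lemma kummer:
  assumes l: "prime l" "of_nat l \<noteq> (0::'a)"
  obtains e where "\<not> l dvd e" "\<And>u. u \<in> L \<Longrightarrow> u \<noteq> 0 \<Longrightarrow> \<exists>w\<in>M. w \<noteq> 0 \<and> \<rho> u = u ^ e * w ^ l"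
proof -
  have l0: "l > 0" using prime_gt_0_nat[OF l(1)] .
  obtain \<zeta> :: 'a where \<zeta>: "\<zeta> ^ l = 1" "\<zeta> \<noteq> 1" using root_of_unity_exists[OF ac l] by blast
  have "\<rho> \<zeta> ^ l = 1" using field_hom_power[OF \<rho>, of \<zeta> l] \<zeta>(1) field_hom_1[OF \<rho>] by simp
  then obtain e where e: "\<rho> \<zeta> = \<zeta> ^ e" using root_of_unity_is_power[OF l(1) \<zeta>] by blast
  have "\<rho> \<zeta> \<noteq> 1" using \<zeta>(2) field_hom_inj[OF \<rho>] field_hom_1[OF \<rho>] by (metis injD)
  hence le: "\<not> l dvd e" using prime_order[OF l(1) \<zeta>, of e] e by simp
  have \<rho>_unity: "\<rho> \<eta> = \<eta> ^ e" if \<eta>: "\<eta> ^ l = 1" for \<eta>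
  proof -
    obtain i where i: "\<eta> = \<zeta> ^ i" using root_of_unity_is_power[OF l(1) \<zeta> \<eta>] by blast
    have "\<rho> \<eta> = (\<zeta> ^ e) ^ i" by (simp add: i field_hom_power[OF \<rho>] e)
    thus ?thesis by (simp add: i mult.commute flip: power_mult)
  qed
  have "\<exists>w\<in>M. w \<noteq> 0 \<and> \<rho> u = u ^ e * w ^ l" if u: "u \<in> L" "u \<noteq> 0" for u
  proof -
    obtain z where z: "z ^ l = u" using nth_root_exists[OF ac l0] by blast
    have z0: "z \<noteq> 0" using z u(2) l0 by (auto simp: power_0_left)
    define w where "w = \<rho> z / z ^ e"
    have "\<tau> w = w" if \<tau>: "\<tau> \<in> Aut_over L" for \<tau>
    proof -
      note h = Aut_over_hom[OF \<tau>]
      define \<eta> where "\<eta> = \<tau> z / z"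
      have \<tau>z: "\<tau> z = \<eta> * z" using z0 by (simp add: \<eta>_def)
      have "\<tau> z ^ l = u" using field_hom_power[OF h, of z l] z Aut_over_fixes[OF \<tau> u(1)] by simp
      hence \<eta>l: "\<eta> ^ l = 1" using z u(2) by (simp add: \<eta>_def power_divide)
      have \<eta>0: "\<eta> \<noteq> 0" using \<eta>l l0 by (auto simp: power_0_left)
      have "\<tau> w = \<tau> (\<rho> z) / \<tau> z ^ e"
        by (simp add: w_def divide_inverse field_hom_mult[OF h] field_hom_inverse[OF h] field_hom_power[OF h])
      also have "\<tau> (\<rho> z) = \<eta> ^ e * \<rho> z"
        using comm[OF \<tau>, of z] \<tau>z by (simp add: field_hom_mult[OF \<rho>] \<rho>_unity[OF \<eta>l])
      also have "\<eta> ^ e * \<rho> z / \<tau> z ^ e = w" using \<eta>0 by (simp add: \<tau>z w_def power_mult_distrib)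
      finally show ?thesis .
    qed
    hence "w \<in> M" by (simp add: M_def)
    moreover have "w \<noteq> 0" using z0 field_hom_eq_0_iff[OF \<rho>] by (simp add: w_def)
    moreover have "\<rho> u = u ^ e * w ^ l"
    proof -
      have "\<rho> z = z ^ e * w" using z0 by (simp add: w_def)
      hence "\<rho> u = (z ^ e * w) ^ l" using field_hom_power[OF \<rho>, of z l] z by simp
      also have "\<dots> = (z ^ l) ^ e * w ^ l" by (simp add: power_mult_distrib mult.commute flip: power_mult)
      finally show ?thesis by (simp add: z)
    qed
    ultimately show ?thesis by blast
  qed
  thus ?thesis using that le by blast
qed

text \<open>Constants that \<open>\<rho>\<close> keeps constant; the roots of unity among them make
  this field infinite.\<close>

definition k2 where "k2 = {c\<in>k1. \<rho> c \<in> k1}"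

lemma subfield_k2: "subfield k2"
  unfolding subfield_def k2_def
  using k1 by (auto simp: field_hom_0[OF \<rho>] field_hom_1[OF \<rho>] field_hom_add[OF \<rho>] field_hom_mult[OF \<rho>]
      field_hom_minus[OF \<rho>] field_hom_inverse[OF \<rho>]
      intro: subfield_0 subfield_1 subfield_add subfield_mult subfield_minus subfield_inverse)

lemma unity_roots_k2: "unity_roots \<subseteq> k2"
proof
  fix c :: 'a assume "c \<in> unity_roots"
  then obtain n where n: "n > 0" "c ^ n = 1" by (auto simp: unity_roots_def)
  have *: "d \<in> k1" if "d ^ n = 1" for d
    using algebraic_if_power[OF k1 n(1), of d] that subfield_1[OF k1] closed by simp
  have "\<rho> c ^ n = 1" using field_hom_power[OF \<rho>, of c n] n(2) field_hom_1[OF \<rho>] by simp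
  thus "c \<in> k2" using *[OF n(2)] *[of "\<rho> c"] by (simp add: k2_def)
qed

lemma infinite_k2: "infinite k2"
  using unity_roots_k2 infinite_unity_roots[OF ac] finite_subset by blast

text \<open>Applying all conjugations to the Kummer relation and multiplying takes its norm;
  \<open>c - x\<close> lies in \<open>E0\<close> and is left fixed.\<close>

lemma char_poly_M_\<rho>:
  assumes c: "c \<in> k2" and w: "w \<in> M" and eq: "\<rho> (c - x) = (c - x) ^ e * w ^ l"
  shows "poly (char_poly_M (\<rho> x)) (\<rho> c) = (c - x) ^ (card conjugations * e) * norm_M w ^ l"
proof -
  have cE: "c \<in> E0" "\<rho> c \<in> E0" using c k1_E0 by (auto simp: k2_def)
  have xM: "\<rho> x \<in> M" using x_E0 E0_L by (intro \<rho>_M) auto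
  have "\<rho> c - \<omega> (\<rho> x) = (c - x) ^ e * \<omega> w ^ l" if \<omega>: "\<omega> \<in> conjugations" for \<omega>
  proof -
    obtain \<tau> where \<tau>: "\<tau> \<in> Aut_over E0" "\<And>z. z \<in> M \<Longrightarrow> \<omega> z = \<tau> z" using conjugationE[OF \<omega>] by metis
    note h = Aut_over_hom[OF \<tau>(1)]
    have "\<rho> c - \<omega> (\<rho> x) = \<tau> (\<rho> (c - x))"
      by (simp add: \<tau>(2)[OF xM] field_hom_diff[OF \<rho>] field_hom_diff[OF h] Aut_over_fixes[OF \<tau>(1) cE(2)])
    also have "\<dots> = \<tau> (c - x) ^ e * \<tau> w ^ l"
      by (simp add: eq field_hom_mult[OF h] field_hom_power[OF h])
    also have "\<tau> (c - x) = c - x"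
      using Aut_over_fixes[OF \<tau>(1) subfield_diff[OF E0 cE(1) x_E0]] .
    finally show ?thesis by (simp add: \<tau>(2)[OF w])
  qed
  hence "poly (char_poly_M (\<rho> x)) (\<rho> c) = (\<Prod>\<omega>\<in>conjugations. (c - x) ^ e * \<omega> w ^ l)"
    unfolding char_poly_M_def poly_prod by (intro prod.cong) auto
  also have "\<dots> = ((c - x) ^ e) ^ card conjugations * norm_M w ^ l"
    by (simp add: prod.distrib norm_M_def prod_power_distrib)
  finally show ?thesis by (simp add: mult.commute flip: power_mult)
qed

theorem power_relation:
  "\<exists>i j. x ^ (char_exp TYPE('a) ^ i) = \<rho> x ^ (char_exp TYPE('a) ^ j) \<and>
     (\<forall>c\<in>unity_roots. c ^ (char_exp TYPE('a) ^ i) = \<rho> c ^ (char_exp TYPE('a) ^ j))"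
proof -
  let ?P = "char_exp TYPE('a)"
  have xM: "\<rho> x \<in> M" using x_E0 E0_L by (intro \<rho>_M) auto
  obtain s where s: "\<And>i. coeff (char_poly_M (\<rho> x)) i ^ (?P ^ s) \<in> E0"
    using char_poly_M_power_in_E0[OF xM] by blast
  have F: "field_hom (\<lambda>z::'a. z ^ (?P ^ s))" by (rule field_hom_power_char_exp)
  \<comment> \<open>Raising the coefficients to the power \<open>?P ^ s\<close> brings them into
    \<open>E0\<close>; roots and arguments are twisted by the same Frobenius power.\<close>
  define \<chi> where "\<chi> = map_poly (\<lambda>z. z ^ (?P ^ s)) (char_poly_M (\<rho> x))"
  have \<chi>: "poly \<chi> (z ^ (?P ^ s)) = poly (char_poly_M (\<rho> x)) z ^ (?P ^ s)" for z
    using field_hom_poly[OF F, of "char_poly_M (\<rho> x)" z] by (simp add: \<chi>_def)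
  have x_k1: "x \<notin> k1" using trans algebraic_self[OF k1] by blast
  interpret kummer_relation k1 k2 x "\<rho> x ^ (?P ^ s)" \<chi> "\<lambda>c. \<rho> c ^ (?P ^ s)" "card conjugations"
  proof unfold_locales
    show "\<And>z. algebraic_over k1 z \<Longrightarrow> z \<in> k1" by (rule closed)
    show "field_hom (\<lambda>c. \<rho> c ^ (?P ^ s))" using field_hom_comp[OF \<rho> F] .
    show "k2 \<subseteq> k1" by (auto simp: k2_def)
    show "(\<lambda>c. \<rho> c ^ (?P ^ s)) ` k2 \<subseteq> k1" using subfield_power[OF k1] by (auto simp: k2_def)
    show "\<chi> \<in> poly_over E0"
      using s by (simp add: poly_over_def \<chi>_def coeff_map_poly field_hom_0[OF F])
    have "poly (char_poly_M (\<rho> x)) (\<rho> x) = 0"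
      unfolding char_poly_M_def poly_prod using finite_conjugations conjugations_id xM
      by (auto simp: prod_zero_iff intro!: bexI[OF _ conjugations_id])
    thus "poly \<chi> (\<rho> x ^ (?P ^ s)) = 0" using char_exp_pos[where 'a='a] by (simp add: \<chi> power_0_left)
  next
    fix c assume y: "\<rho> x ^ (?P ^ s) \<in> k1" and c: "c \<in> k2"
    have "algebraic_over k1 (\<rho> x)" using char_exp_pos[where 'a='a] y by (intro algebraic_if_power[OF k1, of "?P ^ s"]) auto
    hence \<rho>x: "\<rho> x \<in> k1" by (rule closed)
    \<comment> \<open>For \<open>\<rho> x\<close> in \<open>k1\<close> all its conjugates coincide,
      and the characteristic polynomial is a power of one linear factor over
      \<open>k1\<close>.\<close>
    have "\<omega> (\<rho> x) = \<rho> x" if \<omega>: "\<omega> \<in> conjugations" for \<omega>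
    proof -
      obtain \<tau> where \<tau>: "\<tau> \<in> Aut_over E0" "\<omega> (\<rho> x) = \<tau> (\<rho> x)" using conjugationE[OF \<omega>] xM by metis
      thus ?thesis using Aut_over_fixes[OF \<tau>(1)] \<rho>x k1_E0 by auto
    qed
    hence "poly (char_poly_M (\<rho> x)) (\<rho> c) = (\<rho> c - \<rho> x) ^ card conjugations"
      unfolding char_poly_M_def poly_prod prod_constant[symmetric] by (intro prod.cong) auto
    also have "\<dots> \<in> k1" using c \<rho>x by (intro subfield_power subfield_diff k1) (auto simp: k2_def)
    finally show "poly \<chi> (\<rho> c ^ (?P ^ s)) \<in> k1" unfolding \<chi> by (rule subfield_power[OF k1])
  next
    fix c l assume c: "c \<in> k2" and l: "prime l" "of_nat l \<noteq> (0::'a)"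
    obtain e where e: "\<not> l dvd e" "\<And>u. u \<in> L \<Longrightarrow> u \<noteq> 0 \<Longrightarrow> \<exists>w\<in>M. w \<noteq> 0 \<and> \<rho> u = u ^ e * w ^ l"
      using kummer[OF l] by metis
    have ck: "c \<in> k1" using c by (simp add: k2_def)
    have "c - x \<in> L" using subfield_diff[OF E0 _ x_E0, of c] ck k1_E0 E0_L by blast
    moreover have "c - x \<noteq> 0" using ck x_k1 by auto
    ultimately obtain w where w: "w \<in> M" "w \<noteq> 0" "\<rho> (c - x) = (c - x) ^ e * w ^ l" using e(2) by blast
    obtain t where t: "norm_M w ^ (?P ^ t) \<in> E0" using norm_M_power_in_E0[OF w(1)] by blast
    let ?n = "card conjugations"
    \<comment> \<open>The exponent \<open>t\<close> brings the norm into \<open>E0\<close>, and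
      \<open>s\<close> matches the twist in \<open>\<chi>\<close>. Neither spoils \<open>e\<close>,
      because \<open>l\<close> does not divide a power of \<open>?P\<close>.\<close>
    define v where "v = (norm_M w ^ (?P ^ t)) ^ (?P ^ s)"
    have "v \<in> E0" unfolding v_def by (rule subfield_power[OF E0 t])
    moreover have "v \<noteq> 0" unfolding v_def using norm_M_nonzero[OF w(1,2)] by simp
    moreover have "\<not> l dvd e * ?P ^ s * ?P ^ t"
      using e(1) good_prime_not_dvd_char_exp_power[OF l] by (simp add: prime_dvd_mult_iff l(1))
    moreover have "poly \<chi> (\<rho> c ^ (?P ^ s)) ^ (?P ^ t) = (c - x) ^ (?n * (e * ?P ^ s * ?P ^ t)) * v ^ l"
    proof -
      have "poly \<chi> (\<rho> c ^ (?P ^ s)) ^ (?P ^ t) = (((c - x) ^ (?n * e) * norm_M w ^ l) ^ (?P ^ s)) ^ (?P ^ t)"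
        by (simp only: \<chi> char_poly_M_\<rho>[OF c w(1,3)])
      also have "\<dots> = (c - x) ^ (?n * e * ?P ^ s * ?P ^ t) * norm_M w ^ (l * ?P ^ s * ?P ^ t)"
        by (simp only: power_mult_distrib power_mult)
      also have "norm_M w ^ (l * ?P ^ s * ?P ^ t) = v ^ l"
        unfolding v_def by (simp add: mult_ac flip: power_mult)
      finally show ?thesis by (simp only: mult.assoc)
    qed
    ultimately show "\<exists>e t v. \<not> l dvd e \<and> v \<in> E0 \<and> v \<noteq> 0 \<and>
        poly \<chi> (\<rho> c ^ (?P ^ s)) ^ (?P ^ t) = (c - x) ^ (?n * e) * v ^ l" by blast
  qed (use ac k1 trans subfield_k2 infinite_k2 card_conjugations in auto)
  obtain i j where ij: "x ^ (?P ^ i) = (\<rho> x ^ (?P ^ s)) ^ (?P ^ j)"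
    "\<forall>c\<in>k2. c ^ (?P ^ i) = (\<rho> c ^ (?P ^ s)) ^ (?P ^ j)"
    using power_relation by blast
  have "(z ^ (?P ^ s)) ^ (?P ^ j) = z ^ (?P ^ (s + j))" for z :: 'a
    by (simp add: power_add power_mult)
  thus ?thesis using ij unity_roots_k2 by (intro exI[of _ i] exI[of _ "s + j"]) auto
qed

end

subsection \<open>Triviality of commuting automorphisms\<close>

text \<open>\<open>k1\<close> comes from maximality, and the finitely many generators of
  \<open>K\<close> over \<open>k\<close> are adjoined to \<open>k1(x)\<close>.\<close>

lemma function_field_setup:
  fixes k K :: "'a::field set"
  assumes fg: "fin_gen_ext k K" and x: "\<not> algebraic_over k x"
  obtains k1 L where "subfield k1" "\<not> algebraic_over k1 x" "\<And>z. algebraic_over k1 z \<Longrightarrow> z \<in> k1"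
    "\<And>z. algebraic_over (frac_field k1 x) z" "fin_ext (frac_field k1 x) L" "K \<subseteq> L"
proof -
  obtain S where S: "finite S" "K = gen_subfield (k \<union> S)" and k: "subfield k"
    using fg by (auto simp: fin_gen_ext_def)
  obtain k1 where k1: "subfield k1" "k \<subseteq> k1" "\<not> algebraic_over k1 x"
    "\<And>z. algebraic_over k1 z \<Longrightarrow> z \<in> k1" "\<And>z. algebraic_over (frac_field k1 x) z"
    using maximal_subfield_transcendental[OF k x] by metis
  obtain L where L: "fin_ext (frac_field k1 x) L" "S \<subseteq> L"
    using fin_ext_adjoin_finite[OF subfield_frac_field[OF k1(1)] S(1) k1(5)] by blast
  have "k \<union> S \<subseteq> L" "subfield L"
    using L k1(2) subset_frac_field[OF k1(1), of x] by (auto simp: fin_ext_def)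
  hence "K \<subseteq> L" unfolding S(2) gen_subfield_def by blast
  thus ?thesis using that[OF k1(1,3,4,5) L(1)] by blast
qed

text \<open>A root \<open>u\<close> of \<open>x\<close> of order \<open>Q > card B\<close> satisfies
  a relation of degree at most \<open>card B\<close> over \<open>k1(x)\<close>, where
  \<open>x = u ^ Q\<close>. Its terms have exponents distinct modulo \<open>Q\<close>, so nothing
  cancels and \<open>u\<close> is algebraic over \<open>k1\<close>, contradicting transcendence of
  \<open>x\<close>.\<close>

lemma not_infinitely_divisible:
  fixes k K :: "'a::field set"
  assumes fg: "fin_gen_ext k K" and x: "\<not> algebraic_over k x" and r: "r \<ge> 2"
    and roots: "\<And>n. \<exists>u\<in>K. u ^ (r ^ n) = x"
  shows False
proof -
  obtain k1 L where k1: "subfield k1" "\<not> algebraic_over k1 x" "\<And>z. algebraic_over k1 z \<Longrightarrow> z \<in> k1"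
    "\<And>z. algebraic_over (frac_field k1 x) z" "fin_ext (frac_field k1 x) L" "K \<subseteq> L"
    using function_field_setup[OF fg x] by metis
  obtain B where B: "finite B" "L \<subseteq> span_over (frac_field k1 x) B" and L: "subfield L"
    using k1(5) by (auto simp: fin_ext_def)
  define Q where "Q = r ^ card B"
  have Q: "card B < Q" unfolding Q_def using r by (intro power_gt_expt) simp
  obtain u where u: "u \<in> K" "u ^ Q = x" using roots Q_def by blast
  let ?I = "{..card B}"
  have "u ^ i \<in> span_over (frac_field k1 x) B" for i using u(1) k1(6) B(2) subfield_power[OF L] by blast
  then obtain c where c: "\<forall>i\<in>?I. c i \<in> frac_field k1 x" "\<exists>i\<in>?I. c i \<noteq> 0" "(\<Sum>i\<in>?I. c i * u ^ i) = 0"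
    using linear_dependence[OF subfield_frac_field[OF k1(1)] B(1), of ?I "\<lambda>i. u ^ i" x] by auto
  obtain D where D: "poly D x \<noteq> 0" "\<forall>i\<in>?I. \<exists>f\<in>poly_over k1. poly D x * c i = poly f x"
    using common_denominator[OF k1(1), of ?I c x] c(1) by auto
  obtain f where f: "\<forall>i\<in>?I. f i \<in> poly_over k1 \<and> poly D x * c i = poly (f i) x"
    using bchoice[OF D(2)[unfolded Bex_def]] by blast
  define N where "N = Max ((\<lambda>i. degree (f i)) ` ?I)"
  have N: "degree (f i) \<le> N" if "i \<in> ?I" for i unfolding N_def using that by (intro Max_ge) auto
  \<comment> \<open>Substituting \<open>X ^ Q\<close> for \<open>x\<close> in each
    \<open>f i\<close> and multiplying by \<open>X ^ i\<close> gives a polynomial over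
    \<open>k1\<close> that vanishes at \<open>u\<close>.\<close>
  define h where "h = (\<Sum>p\<in>?I \<times> {..N}. monom (coeff (f (fst p)) (snd p)) (Q * snd p + fst p))"
  have "h \<in> poly_over k1" unfolding h_def
    using f by (intro poly_over_sum poly_over_monom k1(1)) (auto intro: poly_over_coeff)
  moreover have "poly h u = 0"
  proof -
    have "poly h u = (\<Sum>p\<in>?I \<times> {..N}. coeff (f (fst p)) (snd p) * (u ^ Q) ^ snd p * u ^ fst p)"
      by (simp add: h_def poly_sum poly_monom power_add power_mult mult.assoc)
    also have "\<dots> = (\<Sum>i\<in>?I. \<Sum>j\<le>N. coeff (f i) j * x ^ j * u ^ i)"
      unfolding u(2) by (simp add: sum.cartesian_product split_def)
    also have "\<dots> = (\<Sum>i\<in>?I. poly D x * (c i * u ^ i))"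
    proof (rule sum.cong[OF refl])
      fix i assume i: "i \<in> ?I"
      have "(\<Sum>j\<le>N. coeff (f i) j * x ^ j) = (\<Sum>j\<le>degree (f i). coeff (f i) j * x ^ j)"
        using N[OF i] by (intro sum.mono_neutral_right) (auto simp: coeff_eq_0)
      also have "\<dots> = poly D x * c i" using bspec[OF f i] by (simp add: poly_altdef)
      finally have "(\<Sum>j\<le>N. coeff (f i) j * x ^ j) * u ^ i = poly D x * c i * u ^ i" by simp
      thus "(\<Sum>j\<le>N. coeff (f i) j * x ^ j * u ^ i) = poly D x * (c i * u ^ i)"
        by (simp add: sum_distrib_right mult.assoc)
    qed
    also have "\<dots> = poly D x * (\<Sum>i\<in>?I. c i * u ^ i)" by (rule sum_distrib_left[symmetric])
    finally show ?thesis by (simp only: c(3) mult_zero_right)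
  qed
  moreover have "h \<noteq> 0"
  proof -
    obtain i where i: "i \<in> ?I" "c i \<noteq> 0" using c(2) by blast
    have "poly (f i) x \<noteq> 0" using bspec[OF f i(1)] i(2) D(1) by (metis mult_eq_0_iff)
    hence "f i \<noteq> 0" by auto
    then obtain j where j: "coeff (f i) j \<noteq> 0" by (metis leading_coeff_0_iff)
    have jN: "j \<le> N" using le_degree[OF j] N[OF i(1)] by simp
    have "coeff h (Q * j + i) = (\<Sum>p\<in>?I \<times> {..N}. if p = (i, j) then coeff (f i) j else 0)"
      unfolding h_def coeff_sum
    proof (rule sum.cong[OF refl])
      fix p assume p: "p \<in> ?I \<times> {..N}"
      have "fst p < Q" "i < Q" using p i(1) Q by auto
      hence "Q * snd p + fst p = Q * j + i \<longleftrightarrow> p = (i, j)"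
        by (metis add.commute div_mult_self2 div_less mod_less mod_mult_self2 add_0 less_nat_zero_code prod.collapse prod.inject)
      thus "coeff (monom (coeff (f (fst p)) (snd p)) (Q * snd p + fst p)) (Q * j + i)
          = (if p = (i, j) then coeff (f i) j else 0)" by auto
    qed
    also have "\<dots> = coeff (f i) j" using i(1) jN by (subst sum.delta) auto
    finally show ?thesis using j by auto
  qed
  ultimately have "algebraic_over k1 u" by (auto simp: algebraic_over_iff)
  hence "u \<in> k1" by (rule k1(3))
  hence "x \<in> k1" using subfield_power[OF k1(1), of u Q] u(2) by simp
  thus False using k1(2) algebraic_self[OF k1(1)] by blast
qed

lemma power_relation_of_commuting_hom:
  fixes k K :: "'a::field set"
  assumes ac: "alg_closed_subfield (UNIV :: 'a set)" and fg: "fin_gen_ext k K"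
    and \<rho>: "field_hom \<rho>" and comm: "\<And>\<tau> z. \<tau> \<in> Aut_over K \<Longrightarrow> \<rho> (\<tau> z) = \<tau> (\<rho> z)"
    and x: "\<not> algebraic_over k x"
  shows "\<exists>i j. x ^ (char_exp TYPE('a) ^ i) = \<rho> x ^ (char_exp TYPE('a) ^ j) \<and>
     (\<forall>c\<in>unity_roots. c ^ (char_exp TYPE('a) ^ i) = \<rho> c ^ (char_exp TYPE('a) ^ j))"
proof -
  obtain k1 L where k1: "subfield k1" "\<not> algebraic_over k1 x" "\<And>z. algebraic_over k1 z \<Longrightarrow> z \<in> k1"
    "\<And>z. algebraic_over (frac_field k1 x) z" "fin_ext (frac_field k1 x) L" "K \<subseteq> L"
    using function_field_setup[OF fg x] by metis
  interpret commuting_hom k1 x L \<rho>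
  proof unfold_locales
    show "\<rho> (\<tau> z) = \<tau> (\<rho> z)" if "\<tau> \<in> Aut_over L" for \<tau> z
      using comm Aut_over_mono[OF k1(6)] that by blast
  qed (use ac k1 \<rho> in auto)
  show ?thesis by (rule power_relation)
qed

lemma power_eq_on_unity_roots:
  assumes ac: "alg_closed_subfield (UNIV :: 'a::field set)"
    and "\<And>c::'a. c \<in> unity_roots \<Longrightarrow> c ^ m = c ^ n"
  shows "m = n"
proof -
  have "monom 1 m - monom 1 n = (0 :: 'a poly)"
    by (rule poly_eq_0_if_infinite_roots[OF infinite_unity_roots[OF ac]]) (use assms(2) in \<open>simp add: poly_monom\<close>)
  hence "monom 1 m = (monom 1 n :: 'a poly)" by simp
  hence "degree (monom 1 m :: 'a poly) = degree (monom 1 n :: 'a poly)" by simp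
  thus ?thesis by (simp add: degree_monom_eq)
qed

theorem commuting_automorphism_trivial:
  fixes k K :: "'a::field set"
  assumes good: "good_triple k K" and \<rho>: "field_hom \<rho>" and \<rho>K: "\<rho> ` K = K"
    and comm: "\<And>\<tau> z. \<tau> \<in> Aut_over K \<Longrightarrow> \<rho> (\<tau> z) = \<tau> (\<rho> z)"
  shows "\<rho> z = z"
proof -
  let ?P = "char_exp TYPE('a)"
  have ac: "alg_closed_subfield (UNIV :: 'a set)" and fg: "fin_gen_ext k K" and k: "subfield k"
    using good by (auto simp: good_triple_def is_alg_closure_of_def alg_closed_subfield_def)
  obtain x where x: "x \<in> K" "\<not> algebraic_over k x" using good by (auto simp: good_triple_def trdeg_ge_1_def)
  note rel = power_relation_of_commuting_hom[OF ac fg \<rho> comm]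
  obtain a b where ab: "x ^ (?P ^ a) = \<rho> x ^ (?P ^ b)"
    "\<forall>c\<in>unity_roots. c ^ (?P ^ a) = \<rho> c ^ (?P ^ b)" using rel[OF _ x(2)] by blast
  have trans: "w ^ (?P ^ a) = \<rho> w ^ (?P ^ b)" if w: "\<not> algebraic_over k w" for w
  proof -
    obtain i j where ij: "w ^ (?P ^ i) = \<rho> w ^ (?P ^ j)"
      "\<forall>c\<in>unity_roots. c ^ (?P ^ i) = \<rho> c ^ (?P ^ j)" using rel[OF _ w] by blast
    \<comment> \<open>Both pairs of exponents describe the same action of \<open>\<rho>\<close> on
      roots of unity, and these are numerous enough to determine an exponent.\<close>
    have "?P ^ i * ?P ^ b = ?P ^ a * ?P ^ j"
    proof (rule power_eq_on_unity_roots[OF ac])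
      fix c :: 'a assume c: "c \<in> unity_roots"
      have "c ^ (?P ^ i * ?P ^ b) = \<rho> c ^ (?P ^ j * ?P ^ b)" using ij(2) c by (simp add: power_mult)
      also have "\<dots> = c ^ (?P ^ a * ?P ^ j)" using ab(2) c by (simp add: power_mult mult.commute[of "?P ^ j"])
      finally show "c ^ (?P ^ i * ?P ^ b) = c ^ (?P ^ a * ?P ^ j)" .
    qed
    hence "(w ^ (?P ^ a)) ^ (?P ^ j) = w ^ (?P ^ i * ?P ^ b)" by (simp only: power_mult)
    also have "\<dots> = (\<rho> w ^ (?P ^ b)) ^ (?P ^ j)"
      by (simp add: power_mult ij(1)) (simp add: mult.commute flip: power_mult)
    finally show ?thesis by (rule power_char_exp_inj)
  qed
  have all: "w ^ (?P ^ a) = \<rho> w ^ (?P ^ b)" for w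
  proof (cases "algebraic_over k w")
    case True
    \<comment> \<open>An algebraic \<open>w\<close> is shifted by the transcendental
      \<open>x\<close>; additivity of Frobenius then isolates the relation for
      \<open>w\<close>.\<close>
    have "\<not> algebraic_over k (w + x)"
    proof
      assume "algebraic_over k (w + x)"
      hence "algebraic_over k ((w + x) - w)"
        using True subfield_diff[OF subfield_algebraic_elements[OF k], of "w + x" w] by simp
      thus False using x(2) by simp
    qed
    from trans[OF this] show ?thesis
      using ab(1) by (simp add: field_hom_add[OF \<rho>] add_power_char_exp)
  qed (rule trans)
  show ?thesis
  proof (cases "?P = 1 \<or> a = b")
    case True
    hence "?P ^ b = ?P ^ a" by auto
    hence "z ^ (?P ^ a) = \<rho> z ^ (?P ^ a)" using all[of z] by simp
    thus ?thesis using power_char_exp_inj by metis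
  next
    case False
    hence P2: "?P \<ge> 2" using char_exp_pos[where 'a='a] by linarith
    \<comment> \<open>For \<open>a < b\<close> the required root of \<open>w\<close> is
      \<open>\<rho> w\<close>; otherwise \<open>\<rho>\<close> itself is the power map, and
      \<open>K\<close> is its own image under it.\<close>
    have "\<exists>r\<ge>2. \<forall>w\<in>K. \<exists>u\<in>K. w = u ^ r"
    proof (cases "a < b")
      case True
      then obtain d where d: "b = a + d" "d > 0" using less_imp_add_positive by blast
      have "w = \<rho> w ^ (?P ^ d)" for w
      proof (rule power_char_exp_inj)
        show "w ^ (?P ^ a) = (\<rho> w ^ (?P ^ d)) ^ (?P ^ a)"
          using all[of w] by (simp add: d(1) power_add mult.commute flip: power_mult)
      qed
      moreover have "?P ^ d \<ge> 2" using self_le_power[of ?P d] P2 d(2) by linarith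
      ultimately show ?thesis using \<rho>K by (intro exI[of _ "?P ^ d"]) blast
    next
      case F: False
      then obtain d where d: "a = b + d" "d > 0" using less_imp_add_positive[of b a] False by auto
      have \<rho>w: "w ^ (?P ^ d) = \<rho> w" for w
      proof (rule power_char_exp_inj)
        show "(w ^ (?P ^ d)) ^ (?P ^ b) = \<rho> w ^ (?P ^ b)"
          using all[of w] by (simp add: d(1) power_add mult.commute flip: power_mult)
      qed
      have "\<exists>u\<in>K. w = u ^ (?P ^ d)" if w: "w \<in> K" for w
      proof -
        obtain u where "u \<in> K" "w = \<rho> u" using w \<rho>K by blast
        thus ?thesis using \<rho>w[of u] by (intro bexI[of _ u]) auto
      qed
      moreover have "?P ^ d \<ge> 2" using self_le_power[of ?P d] P2 d(2) by linarith
      ultimately show ?thesis by blast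
    qed
    then obtain r where r: "r \<ge> 2" "\<And>w. w \<in> K \<Longrightarrow> \<exists>u\<in>K. w = u ^ r" by blast
    have "\<exists>u\<in>K. u ^ (r ^ n) = x" for n
    proof (induction n)
      case 0
      thus ?case using x(1) by auto
    next
      case (Suc n)
      then obtain u where u: "u \<in> K" "u ^ (r ^ n) = x" by blast
      obtain v where v: "v \<in> K" "u = v ^ r" using r(2)[OF u(1)] by blast
      have "v ^ (r ^ Suc n) = x" using u(2) v(2) by (simp add: power_mult)
      thus ?case using v(1) by blast
    qed
    thus ?thesis using not_infinitely_divisible[OF fg x(2) r(1)] by blast
  qed
qed

text \<open>Through \<open>restrict\<close>, equality of two induced maps means agreement on
  \<open>Aut_over K\<close> alone.\<close>

theorem mainTheorem3:
  fixes k K :: "'a::field set" and k' K' :: "'b::field set"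
  assumes "good_triple k K" and "good_triple k' K'"
  shows "inj_on (\<lambda>\<sigma>. restrict (\<lambda>\<tau>. inv \<sigma> \<circ> \<tau> \<circ> \<sigma>) (Aut_over K)) (Isom_ext K' K)"
proof (rule inj_onI)
  fix \<sigma> \<sigma>' :: "'b \<Rightarrow> 'a"
  assume "\<sigma> \<in> Isom_ext K' K" "\<sigma>' \<in> Isom_ext K' K"
    and eq: "restrict (\<lambda>\<tau>. inv \<sigma> \<circ> \<tau> \<circ> \<sigma>) (Aut_over K) = restrict (\<lambda>\<tau>. inv \<sigma>' \<circ> \<tau> \<circ> \<sigma>') (Aut_over K)"
  hence b: "bij \<sigma>" "bij \<sigma>'" and h: "field_hom \<sigma>" "field_hom \<sigma>'" and i: "\<sigma> ` K' = K" "\<sigma>' ` K' = K"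
    by (auto simp: Isom_ext_def field_iso_def field_hom_def)
  define \<rho> where "\<rho> z = \<sigma> (inv \<sigma>' z)" for z
  have inv': "inv \<sigma>' (\<sigma>' w) = w" for w using b(2) by (simp add: bij_is_inj)
  have sur: "\<sigma> (inv \<sigma> z) = z" "\<sigma>' (inv \<sigma>' z) = z" for z using b by (simp_all add: bij_is_surj surj_f_inv_f)
  have "\<rho> z = z" for z
  proof (rule commuting_automorphism_trivial[OF assms(1)])
    show "field_hom \<rho>" unfolding \<rho>_def by (rule field_hom_comp[OF field_hom_inv[OF h(2) b(2)] h(1)])
    have "inv \<sigma>' ` K = K'" unfolding i(2)[symmetric] by (simp add: image_image inv')
    thus "\<rho> ` K = K" using i(1) by (simp add: \<rho>_def image_image[symmetric, of \<sigma> "inv \<sigma>'"])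
    fix \<tau> z assume \<tau>: "\<tau> \<in> Aut_over K"
    \<comment> \<open>Evaluating the two equal conjugates of \<open>\<tau>\<close> at
      \<open>inv \<sigma>' z\<close> and then applying \<open>\<sigma>\<close> turns their equality
      into commutation of \<open>\<rho>\<close> with \<open>\<tau>\<close>.\<close>
    have "inv \<sigma> \<circ> \<tau> \<circ> \<sigma> = inv \<sigma>' \<circ> \<tau> \<circ> \<sigma>'" using fun_cong[OF eq, of \<tau>] \<tau> by simp
    from fun_cong[OF this, of "inv \<sigma>' z"] have "inv \<sigma> (\<tau> (\<rho> z)) = inv \<sigma>' (\<tau> z)"
      by (simp add: \<rho>_def sur)
    hence "\<sigma> (inv \<sigma> (\<tau> (\<rho> z))) = \<rho> (\<tau> z)" by (simp add: \<rho>_def)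
    thus "\<rho> (\<tau> z) = \<tau> (\<rho> z)" by (simp add: sur)
  qed
  hence "\<sigma> w = \<sigma>' w" for w by (metis \<rho>_def inv')
  thus "\<sigma> = \<sigma>'" by blast
qed

end
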